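(* Let $p$ be an odd prime, let $a$ be a positive integer, and let $m\in\mathbb{Z}$ with $p\nmid m$. Set $\Delta=m(m-4)$ and let $h\in\mathbb{Z}_p$. Then $$\sum_{k=0}^{p^a-1}\binom{hp^a-1}{k}\frac{\binom{2k}{k}}{(-m)^k}\equiv\left(\frac{\Delta}{p^{a-1}}\right)\left(1-\frac{hm}{2}\right)u_{p-\left(\frac{\Delta}{p}\right)}(m-2,1)+\left(\frac{\Delta}{p^a}\right)\left(1+h\left((m-4)^{p-1}-1\right)\right)-\varepsilon\pmod{p^2},$$ where $\varepsilon=h(m-4)$ if $p^a=3$ and $3\mid m-1$, and $\varepsilon=0$ otherwise. In particular, if $hm\equiv 2\pmod p$, then $$\sum_{k=0}^{p^a-1}\binom{hp^a-1}{k}\frac{\binom{2k}{k}}{(-m)^k}\equiv\left(\frac{\Delta}{p^a}\right)\left(1+h\left((m-4)^{p-1}-1\right)\right)+\varepsilon'\pmod{p^2},$$ where $\varepsilon'=m-4$ if $p^a=3$ and $3\mid m-1$, and $\varepsilon'=0$ otherwise.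
   Context: $\mathbb{Z}_p$ is the ring of $p$-adic integers, and congruences modulo $p^2$ are taken in $\mathbb{Z}_p$. For $x\in\mathbb{Z}_p$ and $k\in\{0,1,2,\dots\}$, $\binom xk=\prod_{j=1}^{k}\frac{x-j+1}{j}$. $(-)$ is the Jacobi symbol: $\left(\frac{\Delta}{p^{b}}\right)=\left(\frac{\Delta}{p}\right)^{b}$ with $\left(\frac{\Delta}{p}\right)$ the Legendre symbol (equal to $0$ if $p\mid\Delta$), and $\left(\frac{\Delta}{1}\right)=1$ always. For $A,B\in\mathbb{Z}$ the Lucas sequence $u_n=u_n(A,B)$ is defined by $u_0=0$, $u_1=1$, $u_{n+1}=Au_n-Bu_{n-1}$ for $n\geq 1$. *)

theory Defs
  imports
    "Berlekamp_Zassenhaus.Finite_Field"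
    "HOL-Computational_Algebra.Polynomial_Factorial"
    "HOL-Number_Theory.Number_Theory"
begin

text \<open>
  The prime is a type parameter: \<open>p\<close> is the cardinality of the type \<open>'p\<close> of class
  \<^class>\<open>prime_card\<close>.  The ring of \<open>p\<close>-adic integers is the inverse limit of the rings
  \<open>\<int>/p\<^sup>n\<close>; the residue at level \<open>n\<close> is represented by its least nonnegative representative,
  so that the single coherence equation below also forces \<open>0 \<le> x n < p\<^sup>n\<close>.
\<close>

typedef (overloaded) 'p::prime_card padic_int =
  "{x :: nat \<Rightarrow> int. \<forall>n. x (Suc n) mod int CARD('p) ^ n = x n}"
  by (rule exI[of _ "\<lambda>_. 0"]) simp

setup_lifting type_definition_padic_int

lemma mod_power_Suc_mod_power: "(a mod q ^ Suc n) mod q ^ n = a mod (q ^ n :: int)"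
  by (rule mod_mod_cancel) simp

lemma coherent_mod:
  fixes x :: "nat \<Rightarrow> int"
  assumes "\<forall>n. x (Suc n) mod q ^ n = x n"
  shows "x n mod q ^ n = x n"
  using mod_mod_trivial[of "x (Suc n)" "q ^ n"] spec[OF assms, of n] by (simp only:)

instantiation padic_int :: (prime_card) comm_ring_1
begin

lift_definition zero_padic_int :: "'a padic_int" is "\<lambda>_. 0"
  by simp

lift_definition one_padic_int :: "'a padic_int" is "\<lambda>n. 1 mod int CARD('a) ^ n"
  by (rule mod_power_Suc_mod_power)

lift_definition plus_padic_int :: "'a padic_int \<Rightarrow> 'a padic_int \<Rightarrow> 'a padic_int"
  is "\<lambda>x y n. (x n + y n) mod int CARD('a) ^ n"
  by (subst mod_power_Suc_mod_power, subst mod_add_eq[symmetric], simp only:)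

lift_definition minus_padic_int :: "'a padic_int \<Rightarrow> 'a padic_int \<Rightarrow> 'a padic_int"
  is "\<lambda>x y n. (x n - y n) mod int CARD('a) ^ n"
  by (subst mod_power_Suc_mod_power, subst mod_diff_eq[symmetric], simp only:)

lift_definition uminus_padic_int :: "'a padic_int \<Rightarrow> 'a padic_int"
  is "\<lambda>x n. (- x n) mod int CARD('a) ^ n"
  by (subst mod_power_Suc_mod_power, subst mod_minus_eq[symmetric], simp only:)

lift_definition times_padic_int :: "'a padic_int \<Rightarrow> 'a padic_int \<Rightarrow> 'a padic_int"
  is "\<lambda>x y n. (x n * y n) mod int CARD('a) ^ n"
  by (subst mod_power_Suc_mod_power, subst mod_mult_eq[symmetric], simp only:)

instance
proof
  fix a b c :: "'a padic_int"
  show "a + b + c = a + (b + c)"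
    by transfer (simp add: mod_simps add.assoc)
  show "a + b = b + a"
    by transfer (simp add: add.commute)
  show "0 + a = a"
    by transfer (simp add: coherent_mod)
  show "- a + a = 0"
    by transfer (simp add: mod_simps)
  show "a - b = a + - b"
    by transfer (simp add: mod_simps)
  show "a * b * c = a * (b * c)"
    by transfer (simp add: mod_simps mult.assoc)
  show "a * b = b * a"
    by transfer (simp add: mult.commute)
  show "1 * a = a"
    by transfer (simp add: mod_simps coherent_mod)
  show "(a + b) * c = a * c + b * c"
    by transfer (simp add: mod_simps distrib_right)
  have "CARD('a) > 1"
    using prime_card prime_gt_1_nat by blast
  then show "(0 :: 'a padic_int) \<noteq> 1"
    by transfer (auto simp: fun_eq_iff intro!: exI[of _ 1])
qed

end

lemma Rep_padic_int_mod_power: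
  fixes x :: "'p::prime_card padic_int"
  assumes "n \<le> k"
  shows "Rep_padic_int x k mod int CARD('p) ^ n = Rep_padic_int x n"
  using assms
proof (induction k rule: dec_induct)
  case base
  show ?case by (rule coherent_mod) (use Rep_padic_int[of x] in simp)
next
  case (step k)
  have "Rep_padic_int x k = Rep_padic_int x (Suc k) mod int CARD('p) ^ k"
    using Rep_padic_int[of x] by simp
  then have "Rep_padic_int x k mod int CARD('p) ^ n = Rep_padic_int x (Suc k) mod int CARD('p) ^ n"
    using step.hyps by (simp add: mod_mod_cancel le_imp_power_dvd)
  then show ?case using step.IH by simp
qed

instance padic_int :: (prime_card) idom
proof
  fix a b :: "'a padic_int"
  assume "a \<noteq> 0" "b \<noteq> 0"
  let ?p = "int CARD('a)"
  have p: "prime ?p" by (rule prime_card_int)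
  obtain n where n: "Rep_padic_int a n \<noteq> 0"
    using \<open>a \<noteq> 0\<close> by transfer (auto simp: fun_eq_iff)
  obtain m where m: "Rep_padic_int b m \<noteq> 0"
    using \<open>b \<noteq> 0\<close> by transfer (auto simp: fun_eq_iff)
  define x where "x = Rep_padic_int a (n + m)"
  define y where "y = Rep_padic_int b (n + m)"
  have x: "\<not> ?p ^ n dvd x"
    using n Rep_padic_int_mod_power[of n "n + m" a] by (simp add: x_def dvd_eq_mod_eq_0)
  have y: "\<not> ?p ^ m dvd y"
    using m Rep_padic_int_mod_power[of m "n + m" b] by (simp add: y_def dvd_eq_mod_eq_0)
  have "x \<noteq> 0" "y \<noteq> 0" using x y by auto
  have "\<not> is_unit ?p" using p not_prime_unit by blast
  then have "multiplicity ?p x < n" "multiplicity ?p y < m"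
    using x y \<open>x \<noteq> 0\<close> \<open>y \<noteq> 0\<close> power_dvd_iff_le_multiplicity not_le by blast+
  moreover have "multiplicity ?p (x * y) = multiplicity ?p x + multiplicity ?p y"
    using p \<open>x \<noteq> 0\<close> \<open>y \<noteq> 0\<close> by (intro prime_elem_multiplicity_mult_distrib) auto
  ultimately have "multiplicity ?p (x * y) < n + m" by simp
  then have "\<not> ?p ^ (n + m) dvd x * y"
    using \<open>x \<noteq> 0\<close> \<open>y \<noteq> 0\<close> \<open>\<not> is_unit ?p\<close>
    by (subst power_dvd_iff_le_multiplicity) auto
  then have "Rep_padic_int (a * b) (n + m) \<noteq> 0"
    by (simp add: x_def y_def times_padic_int.rep_eq dvd_eq_mod_eq_0)
  then show "a * b \<noteq> 0"
    by (auto simp: zero_padic_int.rep_eq)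
qed

lemma Rep_padic_int_of_nat:
  "Rep_padic_int (of_nat n :: 'p::prime_card padic_int) k = int n mod int CARD('p) ^ k"
  by (induction n)
    (simp_all add: zero_padic_int.rep_eq one_padic_int.rep_eq plus_padic_int.rep_eq mod_simps)

instance padic_int :: (prime_card) ring_char_0
proof
  show "inj (of_nat :: nat \<Rightarrow> 'a padic_int)"
  proof (rule injI)
    fix i j :: nat
    assume eq: "(of_nat i :: 'a padic_int) = of_nat j"
    let ?p = "CARD('a)"
    have "?p > Suc 0" using prime_card prime_gt_Suc_0_nat by blast
    then have lt: "n < ?p ^ n" for n by (rule power_gt_expt)
    have less: "n < ?p ^ (i + j)" if "n = i \<or> n = j" for n
      using lt[of "i + j"] that by auto
    have "int i mod int ?p ^ (i + j) = int j mod int ?p ^ (i + j)"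
      using arg_cong[OF eq, of "\<lambda>x. Rep_padic_int x (i + j)"]
      by (simp add: Rep_padic_int_of_nat)
    then have "i mod ?p ^ (i + j) = j mod ?p ^ (i + j)"
      by (metis of_nat_eq_iff of_nat_mod of_nat_power)
    then show "i = j" using less by simp
  qed
qed

instance fract :: ("{idom, ring_char_0}") field_char_0
proof
  have "(of_nat n :: 'a fract) = to_fract (of_nat n)" for n
    by (induction n) simp_all
  then show "inj (of_nat :: nat \<Rightarrow> 'a fract)"
    by (auto simp: inj_def)
qed

text \<open>
  The numbers \<open>\<rat>\<^sub>p\<close> are the fraction field of \<open>\<int>\<^sub>p\<close>.  Being a field of characteristic 0, they carry
  the generic binomial coefficient \<^const>\<open>gbinomial\<close>, and \<open>\<int>\<^sub>p\<close> is regarded as a subring of them.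
\<close>

type_synonym 'p padic = "'p padic_int fract"

definition padic_integers :: "'p::prime_card padic set" (\<open>\<int>\<^sub>p\<close>)
  where "\<int>\<^sub>p = range to_fract"

definition padic_cong :: "'p::prime_card padic \<Rightarrow> 'p padic \<Rightarrow> 'p padic \<Rightarrow> bool"
    (\<open>(1[_ = _] '(mod _ in \<int>\<^sub>p'))\<close>)
  where "[x = y] (mod n in \<int>\<^sub>p) \<longleftrightarrow> x \<in> \<int>\<^sub>p \<and> y \<in> \<int>\<^sub>p \<and> (\<exists>z\<in>\<int>\<^sub>p. x - y = n * z)"

fun lucas_u :: "int \<Rightarrow> int \<Rightarrow> nat \<Rightarrow> int" where
  "lucas_u A B 0 = 0"
| "lucas_u A B (Suc 0) = 1"
| "lucas_u A B (Suc (Suc n)) = A * lucas_u A B (Suc n) - B * lucas_u A B n"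

text \<open>The Jacobi symbol \<open>(D / p\<^sup>b)\<close>; it is \<open>1\<close> for \<open>b = 0\<close> even if \<open>p\<close> divides \<open>D\<close>.\<close>

definition jacobi_prime_power :: "int \<Rightarrow> nat \<Rightarrow> nat \<Rightarrow> int"
  where "jacobi_prime_power D p b = Legendre D (int p) ^ b"

end

(*
  Write q = p^a = 2r+1, u_n = u_n(m-2,1), w = u_{r+1} + u_r, D = m(m-4), e = (D/p), X = m^r w.
  Since q/j is divisible by p for 0 < j < q, modulo p^2 the sum is linear in h: it equals S0 - h T with
    S0 = sum_k C(2k,k)/m^k,   T = q sum_k C(2k,k) H_k/m^k.

  The identity m^(n-1) sum_{k<n} C(2k,k)/m^k = sum_{k<n} C(2n,k) u_{n-k} and C(2q,k) == 2 C(q,k) (mod p^2)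
  for 0 < k < q give m^(q-1) S0 == 2 sum_k C(q,k) u_{q-k} - u_q = 2 X - u_q.

  For T, C(2k,k) == C(r,k)(-4)^k (mod p), the sum of C(r,k) H_k x^k is elementary, and
  q/j == -2 C(q,2j) (mod p^2); because sum_j C(q,2j) (m-4)^(r-j) m^j = 4^r w this yields T == 2 (X - D^r).

  If p does not divide D, then X and D^r are congruent modulo p to E = e^a, so that z in {X, D^r}
  satisfies 2 z == E (1 + z^2) (mod p^2), and the squares are known:
  (m-4) w^2 = v_q - 2, where the companion v_q and u_q are determined modulo p^2 by u_{p-e} because the
  roots of x^2 - (m-2) x + 1 have order dividing p (p-e) modulo p^2.
  If p divides m-4, one expands w in powers of m-4; the exceptional term for p^a = 3 is D^r with r = 1.
*)

theory Submission
  imports Defs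
begin

(* Congruences of integers are written with a blank in "( mod": Defs makes "(mod" a token of the p-adic notation. *)

section \<open>Binomial coefficients modulo prime powers\<close>

text \<open>Formally put s + 1/s = sqrt m and s - 1/s = sqrt (m - 4). Then s^2 and s^-2 are the
  roots of x^2 - (m-2) x + 1, and w = (s^q - s^-q) / sqrt (m - 4). This is why one quantity settles
  both sums: expanding (1 + s^2)^q leads to S0, and the terms of (sqrt m + sqrt (m - 4))^q with even
  powers of sqrt m lead to T. Replacing q/j by -2 C(q,2j) serves to create that second expansion.
  The two sums need different precision. Every term of T carries q H_k, a multiple of p, so its
  other factors matter only modulo p. S0 has no such factor and rests on an exact identity. The
  obstacle is X: Frobenius arguments determine it only modulo p. The square of w, however, is tied
  to a Lucas value of index q, which is accessible modulo p^2, and a root known modulo p is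
  recovered from its square by linearising at E. This needs E^2 = 1. If p divides m - 4, then E = 0
  and the square says nothing about the root, so that case is treated apart.\<close>

lemma prime_dvd_choose_prime_power:
  fixes p :: nat
  assumes "prime p" "0 < k" "k < p ^ a"
  shows "p dvd p ^ a choose k"
proof (rule ccontr)
  assume "\<not> p dvd p ^ a choose k"
  then have "coprime (p ^ a) (p ^ a choose k)"
    using assms(1) by (simp add: prime_imp_coprime)
  moreover have "p ^ a dvd k * (p ^ a choose k)"
    using times_binomial_minus1_eq[OF assms(2), of "p ^ a"] by simp
  ultimately have "p ^ a dvd k"
    by (simp add: coprime_dvd_mult_left_iff)
  then show False
    using assms(2,3) by (simp add: nat_dvd_not_less)
qed

text \<open>Vandermonde for q + q: apart from the two ends, every term is a product of two binomials
  divisible by p.\<close>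

lemma choose_double_prime_power_cong:
  fixes p :: nat
  assumes "prime p" "0 < k" "k < p ^ a"
  shows "[int (2 * p ^ a choose k) = 2 * int (p ^ a choose k)] ( mod (int p)\<^sup>2)"
proof -
  let ?q = "p ^ a"
  let ?f = "\<lambda>j. (?q choose j) * (?q choose (k - j))"
  have "{..k} = insert 0 (insert k {0<..<k})"
    using assms(2) by auto
  then have "(2 * ?q) choose k = 2 * (?q choose k) + (\<Sum>j\<in>{0<..<k}. ?f j)"
    using vandermonde[of ?q ?q k] assms(2) by (simp add: mult_2)
  moreover have "p\<^sup>2 dvd (\<Sum>j\<in>{0<..<k}. ?f j)"
  proof (intro dvd_sum)
    fix j assume "j \<in> {0<..<k}"
    then show "p\<^sup>2 dvd ?f j"
      unfolding power2_eq_square using assms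
      by (intro mult_dvd_mono prime_dvd_choose_prime_power) auto
  qed
  ultimately obtain z where "(2 * ?q) choose k = 2 * (?q choose k) + p\<^sup>2 * z"
    by (metis dvdE)
  then have "int (2 * ?q choose k) = 2 * int (?q choose k) + (int p)\<^sup>2 * int z"
    by simp
  then show ?thesis
    by (simp add: cong_iff_dvd_diff)
qed

text \<open>Vandermonde for 2k = q + n: the term j = 0 vanishes because n < k, and each other term
  contains \<open>p ^ a choose j\<close> with 0 < j < q.\<close>

lemma central_binomial_cong_0:
  fixes p :: nat
  assumes "prime p" "k < p ^ a" "p ^ a \<le> 2 * k"
  shows "p dvd (2 * k) choose k"
proof -
  define n where "n = 2 * k - p ^ a"
  have n: "2 * k = p ^ a + n" "n < k" "0 < k"
    using assms unfolding n_def by auto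
  have "p dvd (\<Sum>j\<le>k. (p ^ a choose j) * (n choose (k - j)))"
  proof (intro dvd_sum)
    fix j assume "j \<in> {..k}"
    then show "p dvd (p ^ a choose j) * (n choose (k - j))"
      using assms n by (cases "j = 0") (auto intro!: dvd_mult2 prime_dvd_choose_prime_power simp: binomial_eq_0)
  qed
  then show ?thesis
    unfolding n(1) vandermonde .
qed

lemma sum_choose_Suc:
  fixes f :: "nat \<Rightarrow> 'a::comm_semiring_1"
  shows "(\<Sum>k\<le>Suc n. of_nat (Suc n choose k) * f k)
    = (\<Sum>k\<le>n. of_nat (n choose k) * f k) + (\<Sum>k\<le>n. of_nat (n choose k) * f (Suc k))"
proof -
  have "(\<Sum>k\<le>Suc n. of_nat (Suc n choose k) * f k)
      = f 0 + (\<Sum>k\<le>n. of_nat (n choose k) * f (Suc k)) + (\<Sum>k\<le>n. of_nat (n choose Suc k) * f (Suc k))"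
    by (subst sum.atMost_Suc_shift) (simp add: algebra_simps sum.distrib)
  also have "\<dots> = (f 0 + (\<Sum>k\<le>n. of_nat (n choose Suc k) * f (Suc k))) + (\<Sum>k\<le>n. of_nat (n choose k) * f (Suc k))"
    by (simp add: add_ac)
  also have "f 0 + (\<Sum>k\<le>n. of_nat (n choose Suc k) * f (Suc k)) = (\<Sum>k\<le>Suc n. of_nat (n choose k) * f k)"
    by (subst sum.atMost_Suc_shift) simp
  finally show ?thesis
    by (simp add: binomial_eq_0)
qed

text \<open>
  With \<open>E\<close> the shift of sequences, the hypothesis says \<open>(c + d E)\<^sup>2 f = K E\<^sup>s f\<close>.
\<close>

lemma shift_operator_power:
  fixes f :: "nat \<Rightarrow> 'a::comm_semiring_1"
  assumes "\<And>j. c\<^sup>2 * f j + 2 * c * d * f (Suc j) + d\<^sup>2 * f (Suc (Suc j)) = K * f (j + s)"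
  shows "(\<Sum>k\<le>2 * r. of_nat (2 * r choose k) * (c ^ (2 * r - k) * d ^ k * f (j + k))) = K ^ r * f (j + r * s)"
proof -
  \<comment> \<open>\<open>S n j\<close> is the value at j of (c + d E)^n f.\<close>
  define S where "S = (\<lambda>n j. \<Sum>k\<le>n. of_nat (n choose k) * (c ^ (n - k) * d ^ k * f (j + k)))"
  have step: "S (Suc n) j = c * S n j + d * S n (Suc j)" for n j
  proof -
    have "(\<Sum>k\<le>n. of_nat (n choose k) * (c ^ (Suc n - k) * d ^ k * f (j + k))) = c * S n j"
      unfolding S_def sum_distrib_left
      by (intro sum.cong refl) (simp add: Suc_diff_le algebra_simps)
    moreover have "(\<Sum>k\<le>n. of_nat (n choose k) * (c ^ (Suc n - Suc k) * d ^ Suc k * f (j + Suc k))) = d * S n (Suc j)"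
      unfolding S_def sum_distrib_left
      by (intro sum.cong refl) (simp add: algebra_simps)
    ultimately show ?thesis
      unfolding S_def sum_choose_Suc by simp
  qed
  have "S (2 * r) j = K ^ r * f (j + r * s)" for j
  proof (induction r arbitrary: j)
    case 0
    then show ?case by (simp add: S_def)
  next
    case (Suc r)
    let ?i = "j + r * s"
    have "S (2 * Suc r) j = c\<^sup>2 * S (2 * r) j + 2 * c * d * S (2 * r) (Suc j) + d\<^sup>2 * S (2 * r) (Suc (Suc j))"
      by (simp add: step algebra_simps power2_eq_square mult_2)
    also have "\<dots> = K ^ r * (c\<^sup>2 * f ?i + 2 * c * d * f (Suc ?i) + d\<^sup>2 * f (Suc (Suc ?i)))"
      unfolding Suc.IH by (simp add: algebra_simps)
    also have "\<dots> = K ^ r * (K * f (?i + s))"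
      by (simp only: assms)
    finally show ?case by (simp add: algebra_simps)
  qed
  then show ?thesis by (simp add: S_def)
qed

section \<open>Lucas sequences\<close>

lemma lucas_u_add:
  "lucas_u A 1 (j + k + 1) = lucas_u A 1 (j + 1) * lucas_u A 1 (k + 1) - lucas_u A 1 j * lucas_u A 1 k"
proof (induction j rule: induct_nat_012)
  case (ge2 j)
  have "lucas_u A 1 (Suc (Suc j) + k + 1) = A * lucas_u A 1 (Suc j + k + 1) - lucas_u A 1 (j + k + 1)"
    by simp
  also have "\<dots> = lucas_u A 1 (Suc (Suc j) + 1) * lucas_u A 1 (k + 1) - lucas_u A 1 (Suc (Suc j)) * lucas_u A 1 k"
    unfolding ge2 by (simp add: algebra_simps)
  finally show ?case .
qed simp_all

text \<open>This is u_{j+1} u_k - u_j u_{k-1} with u_{k-1} replaced by A u_k - u_{k+1}, so that k =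
  0 is covered.\<close>

lemma lucas_u_add':
  "lucas_u A 1 (j + k) = lucas_u A 1 (j + 1) * lucas_u A 1 k + lucas_u A 1 j * lucas_u A 1 (k + 1)
    - A * lucas_u A 1 j * lucas_u A 1 k"
proof (induction j rule: induct_nat_012)
  case (ge2 j)
  have "lucas_u A 1 (Suc (Suc j) + k) = A * lucas_u A 1 (Suc j + k) - lucas_u A 1 (j + k)"
    by simp
  also have "\<dots> = lucas_u A 1 (Suc (Suc j) + 1) * lucas_u A 1 k + lucas_u A 1 (Suc (Suc j)) * lucas_u A 1 (k + 1)
    - A * lucas_u A 1 (Suc (Suc j)) * lucas_u A 1 k"
    unfolding ge2 by (simp add: algebra_simps)
  finally show ?case .
qed simp_all

text \<open>The norm of alpha^n = u_{n+1} - beta u_n, where alpha and beta are the roots of x^2 - A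
  x + 1 and alpha beta = 1.\<close>

lemma lucas_u_norm:
  "(lucas_u A 1 (n + 1))\<^sup>2 - A * lucas_u A 1 n * lucas_u A 1 (n + 1) + (lucas_u A 1 n)\<^sup>2 = 1"
  by (induction n) (simp_all add: algebra_simps power2_eq_square)

text \<open>Both sides satisfy F(n+1) = m F(n) + C(2n,n). On the right, Pascal's rule used twice
  attaches to C(2n,k) the factor u_{n+1-k} + 2 u_{n-k} + u_{n-1-k} = m u_{n-k} for k < n; at k = n
  only u_1 = 1 remains.\<close>

lemma sum_central_binomial_eq_lucas:
  "(\<Sum>k<n. int (2 * k choose k) * m ^ (n - 1 - k)) = (\<Sum>k\<le>n. int (2 * n choose k) * lucas_u (m - 2) 1 (n - k))"
proof (induction n)
  case (Suc n)
  let ?u = "lucas_u (m - 2) 1"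
  let ?c = "\<lambda>k. int (2 * n choose k)"
  have shift1: "(\<Sum>k\<le>Suc N. int (Suc M choose k) * ?u (Suc N - k))
      = (\<Sum>k\<le>N. int (M choose k) * ?u (Suc N - k)) + (\<Sum>k\<le>N. int (M choose k) * ?u (N - k))" for M N
  proof -
    have "(\<Sum>k\<le>Suc N. int (Suc M choose k) * ?u (Suc N - k))
       = (?u (Suc N) + (\<Sum>k\<le>N. int (M choose Suc k) * ?u (N - k))) + (\<Sum>k\<le>N. int (M choose k) * ?u (N - k))"
      by (subst sum.atMost_Suc_shift) (simp add: algebra_simps sum.distrib)
    also have "?u (Suc N) + (\<Sum>k\<le>N. int (M choose Suc k) * ?u (N - k)) = (\<Sum>k\<le>Suc N. int (M choose k) * ?u (Suc N - k))"
      by (subst sum.atMost_Suc_shift) simp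
    finally show ?thesis by simp
  qed
  have "(\<Sum>k\<le>Suc n. int (2 * Suc n choose k) * ?u (Suc n - k))
     = (\<Sum>k\<le>n. int (Suc (2 * n) choose k) * ?u (Suc n - k)) + (\<Sum>k\<le>n. int (Suc (2 * n) choose k) * ?u (n - k))"
    using shift1[where M = "Suc (2 * n)" and N = n] by simp
  also have "(\<Sum>k\<le>n. int (Suc (2 * n) choose k) * ?u (Suc n - k))
      = (\<Sum>k\<le>Suc n. int (Suc (2 * n) choose k) * ?u (Suc n - k))"
    by simp
  also have "\<dots> = (\<Sum>k\<le>n. ?c k * ?u (Suc n - k)) + (\<Sum>k\<le>n. ?c k * ?u (n - k))"
    by (rule shift1)
  also have "(\<Sum>k\<le>n. int (Suc (2 * n) choose k) * ?u (n - k))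
      = (\<Sum>k<n. ?c k * ?u (n - k)) + (\<Sum>k<n. ?c k * ?u (n - 1 - k))"
  proof (cases n)
    case (Suc N)
    then show ?thesis
      using shift1[where M = "2 * n" and N = N] by (simp add: lessThan_Suc_atMost)
  qed simp
  also have "(\<Sum>k\<le>n. ?c k * ?u (Suc n - k)) = (\<Sum>k<n. ?c k * ?u (Suc n - k)) + ?c n"
    by (simp add: lessThan_Suc_atMost[symmetric])
  also have "(\<Sum>k<n. ?c k * ?u (Suc n - k))
       = (\<Sum>k<n. ?c k * ((m - 2) * ?u (n - k) - ?u (n - 1 - k)))"
  proof (intro sum.cong refl)
    fix k assume "k \<in> {..<n}"
    then have "Suc n - k = Suc (Suc (n - 1 - k))" "n - k = Suc (n - 1 - k)"
      by auto
    then show "?c k * ?u (Suc n - k) = ?c k * ((m - 2) * ?u (n - k) - ?u (n - 1 - k))"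
      by simp
  qed
  also have "(\<Sum>k\<le>n. ?c k * ?u (n - k)) = (\<Sum>k<n. ?c k * ?u (n - k))"
    by (simp add: lessThan_Suc_atMost[symmetric])
  finally have *: "(\<Sum>k\<le>Suc n. int (2 * Suc n choose k) * ?u (Suc n - k)) = m * (\<Sum>k\<le>n. ?c k * ?u (n - k)) + ?c n"
    by (simp add: lessThan_Suc_atMost[symmetric] sum_distrib_left algebra_simps sum_subtractf sum.distrib)
  have "(\<Sum>k<Suc n. int (2 * k choose k) * m ^ (Suc n - 1 - k)) = m * (\<Sum>k<n. int (2 * k choose k) * m ^ (n - 1 - k)) + ?c n"
  proof -
    have "(\<Sum>k<n. int (2 * k choose k) * m ^ (n - k)) = m * (\<Sum>k<n. int (2 * k choose k) * m ^ (n - 1 - k))"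
      unfolding sum_distrib_left
    proof (intro sum.cong refl)
      fix k assume "k \<in> {..<n}"
      then have "n - k = Suc (n - 1 - k)" by auto
      then show "int (2 * k choose k) * m ^ (n - k) = m * (int (2 * k choose k) * m ^ (n - 1 - k))"
        by (simp add: algebra_simps)
    qed
    then show ?thesis by simp
  qed
  then show ?case
    using Suc.IH * by simp
qed simp

text \<open>On u, E^2 + 1 = (m-2) E, hence (1 + E)^2 = m E. The odd factor left over from (1 +
  E)^(2r+1) gives the two summands.\<close>

lemma sum_choose_lucas:
  "(\<Sum>k\<le>2 * r + 1. int (2 * r + 1 choose k) * lucas_u (m - 2) 1 (2 * r + 1 - k))
    = m ^ r * (lucas_u (m - 2) 1 (r + 1) + lucas_u (m - 2) 1 r)"
proof -
  let ?u = "lucas_u (m - 2) 1"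
  have even: "(\<Sum>k\<le>2 * r. int (2 * r choose k) * ?u (j + k)) = m ^ r * ?u (j + r)" for j
    using shift_operator_power[of 1 ?u 1 m 1 r j] by (simp add: algebra_simps)
  have "(\<Sum>k\<le>2 * r + 1. int (2 * r + 1 choose k) * ?u (2 * r + 1 - k))
      = (\<Sum>k\<le>Suc (2 * r). int (Suc (2 * r) choose k) * ?u k)"
    by (rule sum.reindex_bij_witness[of _ "\<lambda>k. 2 * r + 1 - k" "\<lambda>k. 2 * r + 1 - k"])
       (simp_all add: binomial_symmetric[symmetric])
  also have "\<dots> = m ^ r * (?u (r + 1) + ?u r)"
    unfolding sum_choose_Suc using even[of 0] even[of 1] by (simp add: algebra_simps)
  finally show ?thesis .
qed

section \<open>Frobenius and Fermat congruences\<close>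

text \<open>Frobenius for the shift: (1 + E)^q == 1 + E^q (mod p). Weights c^(q-k) d^k put into f
  give the same for c + d E.\<close>

lemma sum_choose_ends:
  fixes p :: nat and f :: "nat \<Rightarrow> int"
  assumes "prime p"
  shows "[(\<Sum>k\<le>p ^ a. int (p ^ a choose k) * f k) = f 0 + f (p ^ a)] ( mod int p)"
proof -
  have "p ^ a > 0" using assms by (simp add: prime_gt_0_nat)
  then have "{..p ^ a} = insert 0 (insert (p ^ a) {0<..<p ^ a})"
    by auto
  then have "(\<Sum>k\<le>p ^ a. int (p ^ a choose k) * f k) - (f 0 + f (p ^ a)) = (\<Sum>k\<in>{0<..<p ^ a}. int (p ^ a choose k) * f k)"
    using \<open>p ^ a > 0\<close> by simp
  also have "int p dvd \<dots>"
  proof (intro dvd_sum dvd_mult2)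
    fix k assume "k \<in> {0<..<p ^ a}"
    then show "int p dvd int (p ^ a choose k)"
      using prime_dvd_choose_prime_power[OF assms, of k a] by simp
  qed
  finally show ?thesis
    by (simp add: cong_iff_dvd_diff)
qed

lemma power_prime_power_cong:
  fixes p :: nat and b :: int
  assumes "prime p"
  shows "[b ^ (p ^ a) = b] ( mod int p)"
proof (induction a)
  case (Suc a)
  have nat: "[int n ^ p ^ 1 = int n] ( mod int p)" for n
  proof (induction n)
    case (Suc n)
    have "(int n + 1) ^ p = (\<Sum>k\<le>p ^ 1. int (p ^ 1 choose k) * int n ^ k)"
      by (simp add: binomial_ring)
    also have "[\<dots> = int n ^ 0 + int n ^ p ^ 1] ( mod int p)"
      by (rule sum_choose_ends[OF assms])
    also have "[int n ^ 0 + int n ^ p ^ 1 = 1 + int n] ( mod int p)"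
      using Suc.IH by (intro cong_add) simp_all
    finally show ?case by (simp add: add.commute)
  qed (use prime_gt_0_nat[OF assms] in \<open>simp add: zero_power\<close>)
  have fermat: "[c ^ p = c] ( mod int p)" for c
  proof -
    have c: "[c = int (nat (c mod int p))] ( mod int p)"
      using assms by (simp add: prime_gt_0_nat cong_def)
    then have "[c ^ p = int (nat (c mod int p)) ^ p] ( mod int p)"
      by (rule cong_pow)
    with nat[of "nat (c mod int p)"] c show ?thesis
      by (metis cong_sym cong_trans power_one_right)
  qed
  have "[b ^ (p ^ Suc a) = b ^ p ^ a] ( mod int p)"
    using fermat[of "b ^ p ^ a"] power_mult[of b "p ^ a" p] by (simp add: mult.commute)
  then show ?case using Suc.IH cong_trans by blast
qed simp

lemma power_prime_power_minus_1_cong: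
  fixes p :: nat and b :: int
  assumes "prime p" "\<not> int p dvd b"
  shows "[b ^ (p ^ a - 1) = 1] ( mod int p)"
proof -
  have "p ^ a = Suc (p ^ a - 1)"
    using assms(1) by (simp add: prime_gt_0_nat)
  then have "[b * b ^ (p ^ a - 1) = b * 1] ( mod int p)"
    using power_prime_power_cong[OF assms(1), of b a] by (metis mult.right_neutral power_Suc)
  moreover have "coprime b (int p)"
    using assms by (metis coprime_commute prime_imp_coprime prime_nat_int_transfer)
  ultimately show ?thesis
    using cong_mult_lcancel by blast
qed

text \<open>The exponents differ by p^a - p, a multiple of p (p-1), which is the order of the unit
  group modulo p^2.\<close>

lemma power_prime_power_minus_1_cong_square:
  fixes p :: nat and b :: int
  assumes "prime p" "\<not> int p dvd b" "a > 0"
  shows "[b ^ (p ^ a - 1) = b ^ (p - 1)] ( mod (int p)\<^sup>2)"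
proof -
  obtain c where a: "a = Suc c" using assms(3) by (cases a) auto
  have "1 \<le> p ^ c" "1 \<le> p" using assms(1) by (simp_all add: prime_gt_0_nat Suc_leI)
  have "p - 1 dvd p ^ c - 1"
  proof -
    have "int p - 1 dvd int p ^ c - 1" by (simp add: power_diff_1_eq)
    then have "int (p - 1) dvd int (p ^ c - 1)"
      using \<open>1 \<le> p ^ c\<close> \<open>1 \<le> p\<close> by (simp add: of_nat_diff)
    then show ?thesis by (simp only: of_nat_dvd_iff)
  qed
  then obtain d where d: "p ^ c - 1 = (p - 1) * d" by blast
  have "p ^ a - 1 = (p - 1) + p * (p ^ c - 1)"
    using \<open>1 \<le> p ^ c\<close> \<open>1 \<le> p\<close> a by (simp add: diff_mult_distrib2)
  then have eq: "b ^ (p ^ a - 1) = b ^ (p - 1) * (b ^ (p * (p - 1))) ^ d"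
    using d by (simp add: power_add power_mult mult.assoc)
  obtain t where t: "b ^ (p - 1) = 1 + int p * t"
    using power_prime_power_minus_1_cong[OF assms(1,2), of 1]
    by (metis cong_iff_lin cong_sym power_one_right)
  have "[(1 + int p * t) ^ k = 1 + int k * (int p * t)] ( mod (int p)\<^sup>2)" for k
  proof (induction k)
    case (Suc k)
    have "[(1 + int p * t) * (1 + int p * t) ^ k = (1 + int p * t) * (1 + int k * (int p * t))] ( mod (int p)\<^sup>2)"
      by (intro cong_mult Suc.IH) simp
    also have "[(1 + int p * t) * (1 + int k * (int p * t)) = 1 + int (Suc k) * (int p * t)] ( mod (int p)\<^sup>2)"
      by (simp add: cong_iff_dvd_diff algebra_simps power2_eq_square)
    finally show ?case by simp
  qed simp
  from this[of p] have "[(1 + int p * t) ^ p = 1 + (int p)\<^sup>2 * t] ( mod (int p)\<^sup>2)"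
    by (simp add: power2_eq_square mult.assoc)
  also have "[1 + (int p)\<^sup>2 * t = 1] ( mod (int p)\<^sup>2)"
    by (simp add: cong_iff_dvd_diff)
  finally have "[(1 + int p * t) ^ p = 1] ( mod (int p)\<^sup>2)" .
  then have "[b ^ (p * (p - 1)) = 1] ( mod (int p)\<^sup>2)"
    using t by (metis mult.commute power_mult)
  then have "[(b ^ (p * (p - 1))) ^ d = 1 ^ d] ( mod (int p)\<^sup>2)"
    by (rule cong_pow)
  then have "[b ^ (p - 1) * (b ^ (p * (p - 1))) ^ d = b ^ (p - 1) * 1 ^ d] ( mod (int p)\<^sup>2)"
    by (intro cong_mult) simp_all
  then show ?thesis using eq by simp
qed

text \<open>On u, (2E - A)^2 = A^2 - 4. So (2E - A)^q is (A^2 - 4)^r (2E - A) exactly, and 2 E^q - A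
  modulo p by Frobenius.\<close>

lemma lucas_u_prime_power_shift:
  fixes p :: nat
  assumes "prime p" "p ^ a = 2 * r + 1"
  shows "[2 * lucas_u A 1 (j + p ^ a) = (A\<^sup>2 - 4) ^ r * (2 * lucas_u A 1 (Suc j) - A * lucas_u A 1 j) + A * lucas_u A 1 j] ( mod int p)"
proof -
  let ?u = "lucas_u A 1" and ?q = "p ^ a"
  define f where "f k = (- A) ^ (?q - k) * 2 ^ k * ?u (j + k)" for k
  have even: "(\<Sum>k\<le>2 * r. int (2 * r choose k) * ((- A) ^ (2 * r - k) * 2 ^ k * ?u (i + k)))
     = (A\<^sup>2 - 4) ^ r * ?u i" for i
    using shift_operator_power[of "- A" ?u 2 "A\<^sup>2 - 4" 0 r i]
    by (simp add: algebra_simps power2_eq_square)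
  have "(\<Sum>k\<le>?q. int (?q choose k) * f k) = (\<Sum>k\<le>Suc (2 * r). int (Suc (2 * r) choose k) * f k)"
    using assms(2) by simp
  also have "\<dots> = (\<Sum>k\<le>2 * r. int (2 * r choose k) * f k) + (\<Sum>k\<le>2 * r. int (2 * r choose k) * f (Suc k))"
    by (rule sum_choose_Suc)
  also have "(\<Sum>k\<le>2 * r. int (2 * r choose k) * f k) = - A * ((A\<^sup>2 - 4) ^ r * ?u j)"
    unfolding even[of j, symmetric] sum_distrib_left f_def assms(2)
    by (intro sum.cong refl) (simp add: Suc_diff_le algebra_simps)
  also have "(\<Sum>k\<le>2 * r. int (2 * r choose k) * f (Suc k)) = 2 * ((A\<^sup>2 - 4) ^ r * ?u (Suc j))"
    unfolding even[of "Suc j", symmetric] sum_distrib_left f_def assms(2)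
    by (intro sum.cong refl) (simp add: algebra_simps)
  finally have "[- A * ((A\<^sup>2 - 4) ^ r * ?u j) + 2 * ((A\<^sup>2 - 4) ^ r * ?u (Suc j)) = f 0 + f ?q] ( mod int p)"
    using sum_choose_ends[OF assms(1), of a f] by simp
  also have "[f 0 + f ?q = - A * ?u j + 2 * ?u (j + ?q)] ( mod int p)"
    unfolding f_def using power_prime_power_cong[OF assms(1), of "- A" a] power_prime_power_cong[OF assms(1), of 2 a]
    by (intro cong_add cong_mult) (simp_all)
  finally have "[- A * ((A\<^sup>2 - 4) ^ r * ?u j) + 2 * ((A\<^sup>2 - 4) ^ r * ?u (Suc j)) + A * ?u j = - A * ?u j + 2 * ?u (j + ?q) + A * ?u j] ( mod int p)"
    by (rule cong_add) simp
  then show ?thesis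
    by (simp add: algebra_simps cong_sym)
qed

section \<open>Periods and reflection of Lucas sequences\<close>

text \<open>The hypotheses say alpha^n == 1 (mod d) for a root alpha of x^2 - A x + 1. Then
  alpha^(kn) == 1 + k (alpha^n - 1) (mod d^2), written here in coordinates.\<close>

lemma lucas_u_multiple_cong_square:
  fixes d :: int
  assumes "d dvd lucas_u A 1 n" "d dvd lucas_u A 1 (n + 1) - 1"
  shows "[lucas_u A 1 (k * n) = int k * lucas_u A 1 n] ( mod d\<^sup>2)"
    and "[lucas_u A 1 (k * n + 1) = 1 + int k * (lucas_u A 1 (n + 1) - 1)] ( mod d\<^sup>2)"
proof -
  let ?u = "lucas_u A 1"
  obtain x y where x: "?u n = d * x" and y: "?u (n + 1) = 1 + d * y"
    using assms by (metis add.commute diff_add_cancel dvdE)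
  \<comment> \<open>Explicit multiples of d^2 turn the induction step into a polynomial
    identity.\<close>
  have "(\<exists>s. ?u (k * n) = int k * d * x + d\<^sup>2 * s) \<and> (\<exists>t. ?u (k * n + 1) = 1 + int k * d * y + d\<^sup>2 * t)"
  proof (induction k)
    case (Suc k)
    then obtain s t where s: "?u (k * n) = int k * d * x + d\<^sup>2 * s" and t: "?u (k * n + 1) = 1 + int k * d * y + d\<^sup>2 * t"
      by blast
    have "?u (Suc k * n) = int (Suc k) * d * x
        + d\<^sup>2 * (2 * int k * x * y + t * d * x + s + s * d * y - A * (int k * x * x + d * s * x))"
      using lucas_u_add'[of A "k * n" n] unfolding s t x y
      by (simp add: algebra_simps power2_eq_square)
    moreover have "?u (Suc k * n + 1) = 1 + int (Suc k) * d * y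
        + d\<^sup>2 * (int k * y * y + t * (1 + d * y) - int k * x * x - d * s * x)"
      using lucas_u_add[of A "k * n" n] unfolding s t x y
      by (simp add: algebra_simps power2_eq_square)
    ultimately show ?case by blast
  qed (auto intro!: exI[of _ 0])
  then show "[?u (k * n) = int k * ?u n] ( mod d\<^sup>2)"
      "[?u (k * n + 1) = 1 + int k * (?u (n + 1) - 1)] ( mod d\<^sup>2)"
    unfolding x y by (auto simp: cong_iff_dvd_diff)
qed

lemma lucas_u_period_cong_square:
  fixes d :: int
  assumes "d dvd lucas_u A 1 n" "d dvd lucas_u A 1 (n + 1) - 1" "d dvd int k"
  shows "[lucas_u A 1 (k * n) = 0] ( mod d\<^sup>2)" "[lucas_u A 1 (k * n + 1) = 1] ( mod d\<^sup>2)"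
proof -
  have "d\<^sup>2 dvd int k * lucas_u A 1 n" "d\<^sup>2 dvd int k * (lucas_u A 1 (n + 1) - 1)"
    unfolding power2_eq_square using assms by (auto intro: mult_dvd_mono)
  then have "[int k * lucas_u A 1 n = 0] ( mod d\<^sup>2)" "[1 + int k * (lucas_u A 1 (n + 1) - 1) = 1] ( mod d\<^sup>2)"
    by (simp_all add: cong_iff_dvd_diff)
  then show "[lucas_u A 1 (k * n) = 0] ( mod d\<^sup>2)" "[lucas_u A 1 (k * n + 1) = 1] ( mod d\<^sup>2)"
    using lucas_u_multiple_cong_square[OF assms(1,2), of k] cong_trans by blast+
qed

lemma lucas_u_add_period:
  assumes "[lucas_u A 1 n = 0] ( mod d)" "[lucas_u A 1 (n + 1) = 1] ( mod d)"
  shows "[lucas_u A 1 (j + n) = lucas_u A 1 j] ( mod d)"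
proof -
  have "[lucas_u A 1 (j + n) = lucas_u A 1 (j + 1) * 0 + lucas_u A 1 j * 1 - A * lucas_u A 1 j * 0] ( mod d)"
    unfolding lucas_u_add'[of A j n] using assms by (intro cong_add cong_mult cong_diff) simp_all
  then show ?thesis by simp
qed

text \<open>If alpha^(i+j) == 1, the index i acts as -j, and u_{-j} = - u_j, u_{1-j} = u_{j+1} - A
  u_j.\<close>

lemma lucas_u_reflect:
  assumes "[lucas_u A 1 (i + j) = 0] ( mod d)" "[lucas_u A 1 (i + j + 1) = 1] ( mod d)"
  shows "[lucas_u A 1 i = - lucas_u A 1 j] ( mod d)"
    and "[lucas_u A 1 (i + 1) = lucas_u A 1 (j + 1) - A * lucas_u A 1 j] ( mod d)"
proof -
  let ?u = "lucas_u A 1"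
  have "d dvd ?u (i + 1) * ?u j + ?u i * ?u (j + 1) - A * ?u i * ?u j"
    and "d dvd ?u (i + 1) * ?u (j + 1) - ?u i * ?u j - 1"
    using assms unfolding lucas_u_add lucas_u_add'[of A i j] cong_iff_dvd_diff by simp_all
  then obtain s t where s: "?u (i + 1) * ?u j + ?u i * ?u (j + 1) - A * ?u i * ?u j = d * s"
    and "?u (i + 1) * ?u (j + 1) - ?u i * ?u j - 1 = d * t"
    by (elim dvdE)
  then have t: "?u (i + 1) * ?u (j + 1) - ?u i * ?u j = 1 + d * t"
    by simp
  \<comment> \<open>The addition formulas are a linear system for x = u_{i+1} and y = u_i. Its
    determinant is minus the norm form of w = u_{j+1} and z = u_j, hence -1, so Cramer's rule needs
    no division.\<close>
  have *: "y = - z + d * (s * w - t * z) \<and> x = (w - A * z) + d * (t * (w - A * z) + s * z)"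
    if "x * z + y * w - A * y * z = d * s" "x * w - y * z = 1 + d * t" "w\<^sup>2 - A * z * w + z\<^sup>2 = 1" for x y z w
  proof
    have "y * (w\<^sup>2 - A * z * w + z\<^sup>2) = (x * z + y * w - A * y * z) * w - (x * w - y * z) * z"
      by (simp add: algebra_simps power2_eq_square)
    then show "y = - z + d * (s * w - t * z)"
      unfolding that by (simp add: algebra_simps)
    have "x * (w\<^sup>2 - A * z * w + z\<^sup>2) = (x * w - y * z) * (w - A * z) + (x * z + y * w - A * y * z) * z"
      by (simp add: algebra_simps power2_eq_square)
    then show "x = (w - A * z) + d * (t * (w - A * z) + s * z)"
      unfolding that by (simp add: algebra_simps)
  qed
  have "?u i = - ?u j + d * (s * ?u (j + 1) - t * ?u j)"
    and "?u (i + 1) = (?u (j + 1) - A * ?u j) + d * (t * (?u (j + 1) - A * ?u j) + s * ?u j)"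
    using *[OF s t lucas_u_norm] by blast+
  then show "[?u i = - ?u j] ( mod d)" "[?u (i + 1) = ?u (j + 1) - A * ?u j] ( mod d)"
    unfolding cong_iff_dvd_diff by (metis add_diff_cancel_left' dvd_triv_left)+
qed

text \<open>The right side is v_{2r+1} - 2, where v_n = 2 u_{n+1} - A u_n = alpha^n + beta^n; the
  constant is twice the norm form.\<close>

lemma lucas_u_half_square:
  "(A - 2) * (lucas_u A 1 (r + 1) + lucas_u A 1 r)\<^sup>2
    = 2 * lucas_u A 1 (2 * r + 2) - A * lucas_u A 1 (2 * r + 1) - 2"
proof -
  let ?u = "lucas_u A 1"
  have *: "(A - 2) * (x + y)\<^sup>2 = 2 * ((A * x - y) * x - x * y) - A * (x * x - y * y) - 2"
    if "x\<^sup>2 - A * y * x + y\<^sup>2 = 1" for x y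
  proof -
    have "(A - 2) * (x + y)\<^sup>2 = 2 * ((A * x - y) * x - x * y) - A * (x * x - y * y) - 2 * (x\<^sup>2 - A * y * x + y\<^sup>2)"
      by (simp add: algebra_simps power2_eq_square)
    then show ?thesis using that by simp
  qed
  have "?u (2 * r + 1) = ?u (r + 1) * ?u (r + 1) - ?u r * ?u r"
    using lucas_u_add[of A r r] by (simp add: mult_2)
  moreover have "?u (2 * r + 2) = (A * ?u (r + 1) - ?u r) * ?u (r + 1) - ?u (r + 1) * ?u r"
    using lucas_u_add[of A "r + 1" r] by (simp add: mult_2)
  ultimately show ?thesis
    using *[OF lucas_u_norm] by presburger
qed

section \<open>Even-indexed binomial sums\<close>

text \<open>(sqrt B + sqrt C)^(2r+1) = sqrt B (P r B C) + sqrt C (P r C B), and the recurrence is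
  multiplication by (sqrt B + sqrt C)^2 = B + C + 2 sqrt (B C).\<close>

lemma sum_choose_odd_rec:
  fixes B C :: "'a::comm_ring_1"
  defines "P \<equiv> \<lambda>r B C. \<Sum>j\<le>r. of_nat (2 * r + 1 choose (2 * j)) * (B::'a) ^ (r - j) * C ^ j"
  shows "P (Suc r) B C = (B + C) * P r B C + 2 * C * P r C B"
proof -
  let ?c = "\<lambda>k. of_nat (2 * r + 1 choose k) :: 'a"
  have choose: "of_nat (2 * Suc r + 1 choose (2 * Suc j)) = ?c (2 * Suc j) + 2 * ?c (2 * j + 1) + ?c (2 * j)" for j
    by (simp add: numeral_2_eq_2)
  \<comment> \<open>Reflecting k to 2r + 1 - k exchanges odd and even indices, so the odd half is
    the same sum with B and C exchanged.\<close>
  have refl: "(\<Sum>j\<le>r. ?c (2 * j + 1) * B ^ (r - j) * C ^ j) = P r C B"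
    unfolding P_def
  proof (rule sum.reindex_bij_witness[of _ "\<lambda>j. r - j" "\<lambda>j. r - j"])
    fix j assume j: "j \<in> {..r}"
    then have "2 * r + 1 - (2 * j + 1) = 2 * (r - j)" by auto
    then have "?c (2 * (r - j)) = ?c (2 * j + 1)"
      using j by (subst (2) binomial_symmetric) auto
    then show "?c (2 * (r - j)) * C ^ (r - (r - j)) * B ^ (r - j) = ?c (2 * j + 1) * B ^ (r - j) * C ^ j"
      using j by (simp add: algebra_simps)
  qed auto
  have "P (Suc r) B C = B ^ Suc r + (\<Sum>j\<le>r. (?c (2 * Suc j) + 2 * ?c (2 * j + 1) + ?c (2 * j)) * B ^ (r - j) * C ^ Suc j)"
    unfolding P_def by (subst sum.atMost_Suc_shift, simp only: choose) (simp del: binomial_Suc_Suc)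
  also have "\<dots> = (B ^ Suc r + (\<Sum>j\<le>r. ?c (2 * Suc j) * B ^ (r - j) * C ^ Suc j))
      + 2 * C * (\<Sum>j\<le>r. ?c (2 * j + 1) * B ^ (r - j) * C ^ j) + C * (\<Sum>j\<le>r. ?c (2 * j) * B ^ (r - j) * C ^ j)"
    by (simp del: binomial_Suc_Suc add: sum_distrib_left sum.distrib algebra_simps)
  also have "B ^ Suc r + (\<Sum>j\<le>r. ?c (2 * Suc j) * B ^ (r - j) * C ^ Suc j)
      = (\<Sum>j\<le>Suc r. ?c (2 * j) * B ^ (Suc r - j) * C ^ j)"
    by (subst sum.atMost_Suc_shift) simp
  also have "\<dots> = B * P r B C"
    unfolding P_def sum_distrib_left
    by (simp add: binomial_eq_0 Suc_diff_le algebra_simps)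
  finally show ?thesis
    unfolding refl by (simp add: P_def algebra_simps)
qed

lemma sum_choose_odd_one: "(\<Sum>j\<le>r. of_nat (2 * r + 1 choose (2 * j))) = (4 ^ r :: 'a::comm_ring_1)"
proof (induction r)
  case (Suc r)
  then show ?case
    using sum_choose_odd_rec[of r "1::'a" 1] by simp
qed simp

lemma sum_choose_odd_lucas:
  "(\<Sum>j\<le>r. int (2 * r + 1 choose (2 * j)) * (m - 4) ^ (r - j) * m ^ j)
     = 4 ^ r * (lucas_u (m - 2) 1 (r + 1) + lucas_u (m - 2) 1 r)" (is "?P r (m - 4) m = _")
proof -
  let ?u = "lucas_u (m - 2) 1"
  \<comment> \<open>The recurrence exchanges its two arguments, so the sum with m and m - 4 swapped
    has to be carried through the induction.\<close>
  have "?P r (m - 4) m = 4 ^ r * (?u (r + 1) + ?u r) \<and> ?P r m (m - 4) = 4 ^ r * (?u (r + 1) - ?u r)"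
  proof (induction r)
    case (Suc r)
    then have 1: "?P r (m - 4) m = 4 ^ r * (?u (r + 1) + ?u r)" and 2: "?P r m (m - 4) = 4 ^ r * (?u (r + 1) - ?u r)"
      by blast+
    show ?case
      unfolding sum_choose_odd_rec 1 2 by (simp add: algebra_simps)
  qed simp
  then show ?thesis by simp
qed

lemma odd_power_eq_double_Suc:
  fixes p :: nat
  assumes "odd p"
  shows "p ^ a = 2 * ((p ^ a - 1) div 2) + 1"
  using assms odd_two_times_div_two_succ[of "p ^ a"] by (simp add: odd_two_times_div_two_nat)

lemma cong_imp_ex:
  fixes x y d :: int
  assumes "[x = y] ( mod d)"
  shows "\<exists>t. x = y + d * t"
  using assms by (metis cong_iff_lin cong_sym)

lemma cong_2_times_cancel:
  fixes p :: nat and x y :: int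
  assumes "odd p" "[2 * x = 2 * y] ( mod int p ^ n)"
  shows "[x = y] ( mod int p ^ n)"
  using assms by (simp add: cong_mult_lcancel)

section \<open>Lucas sequences at p and at powers of p\<close>

text \<open>By Euler's criterion for the discriminant, Frobenius sends a root alpha to alpha^e, so
  alpha^(p-e) == 1 (mod p). In terms of u: the shift by p gives u_p and u_{p+1}, and one step of the
  recurrence reaches what is needed around index p - e.\<close>

lemma lucas_u_rank:
  fixes p :: nat
  assumes "prime p" "odd p" "\<not> int p dvd A\<^sup>2 - 4"
  defines "e \<equiv> Legendre (A\<^sup>2 - 4) (int p)"
  shows "e = 1 \<or> e = -1"
    and "int p dvd lucas_u A 1 (nat (int p - e))"
    and "int p dvd lucas_u A 1 (nat (int p - e) + 1) - 1"
    and "[lucas_u A 1 p = e] ( mod int p)"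
proof -
  let ?u = "lucas_u A 1" and ?D = "A\<^sup>2 - 4"
  define r where "r = (p - 1) div 2"
  have r: "p ^ 1 = 2 * r + 1"
    using odd_power_eq_double_Suc[OF assms(2), of 1] by (simp add: r_def)
  have "p > 2"
    using assms(1,2) prime_gt_1_nat[of p] by (cases "p = 2") auto
  have "e = 0 \<longleftrightarrow> int p dvd ?D"
    by (simp add: e_def Legendre_def cong_0_iff)
  with assms(3) show e: "e = 1 \<or> e = -1"
    by (auto simp: e_def Legendre_def)
  have euler: "[e = ?D ^ r] ( mod int p)"
    unfolding e_def r_def
    by (rule euler_criterion) (use \<open>prime p\<close> \<open>p > 2\<close> in auto)
  have "[2 * ?u (0 + p ^ 1) = ?D ^ r * (2 * ?u (Suc 0) - A * ?u 0) + A * ?u 0] ( mod int p)"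
    by (rule lucas_u_prime_power_shift[OF assms(1) r])
  moreover have "[?D ^ r * (2 * ?u (Suc 0) - A * ?u 0) + A * ?u 0 = 2 * e] ( mod int p)"
    using cong_scalar_left[OF cong_sym[OF euler], of 2] by (simp add: mult.commute)
  ultimately have "[2 * ?u p = 2 * e] ( mod int p ^ 1)"
    using cong_trans by fastforce
  then have "[?u p = e] ( mod int p ^ 1)"
    by (rule cong_2_times_cancel[OF assms(2)])
  then show up: "[?u p = e] ( mod int p)" by simp
  have "[2 * ?u (1 + p ^ 1) = ?D ^ r * (2 * ?u (Suc 1) - A * ?u 1) + A * ?u 1] ( mod int p)"
    by (rule lucas_u_prime_power_shift[OF assms(1) r])
  moreover have "[?D ^ r * (2 * ?u (Suc 1) - A * ?u 1) + A * ?u 1 = e * A + A] ( mod int p)"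
    using cong_scalar_right[OF cong_sym[OF euler], of A] by (intro cong_add) simp_all
  ultimately have up1: "[2 * ?u (p + 1) = e * A + A] ( mod int p)"
    using cong_trans by fastforce
  show "int p dvd ?u (nat (int p - e))" "int p dvd ?u (nat (int p - e) + 1) - 1"
  proof -
    consider "e = 1" | "e = -1" using e by blast
    then have "int p dvd ?u (nat (int p - e)) \<and> int p dvd ?u (nat (int p - e) + 1) - 1"
    proof cases
      case 1
      have n: "nat (int p - e) = p - 1" using 1 by simp
      obtain k where k: "p = Suc k" using \<open>p > 2\<close> by (cases p) auto
      have "[2 * ?u (p + 1) = 2 * A] ( mod int p ^ 1)"
        using up1 1 by simp
      then have "[?u (p + 1) = A] ( mod int p)"
        using cong_2_times_cancel[OF assms(2), of "?u (p + 1)" A 1] by simp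
      then have "[A * ?u p - ?u (p + 1) = A * 1 - A] ( mod int p)"
        using up 1 by (intro cong_diff cong_mult) simp_all
      then show ?thesis
        using up 1 unfolding n k by (simp add: cong_iff_dvd_diff)
    next
      case 2
      have n: "nat (int p - e) = Suc p" using 2 by simp
      have "[2 * ?u (p + 1) = 2 * 0] ( mod int p ^ 1)"
        using up1 2 by simp
      then have *: "[?u (p + 1) = 0] ( mod int p)"
        using cong_2_times_cancel[OF assms(2), of "?u (p + 1)" 0 1] by simp
      then have "[A * ?u (p + 1) - ?u p = A * 0 - (-1)] ( mod int p)"
        using up 2 by (intro cong_diff cong_mult) simp_all
      then show ?thesis
        using * unfolding n by (simp add: cong_iff_dvd_diff)
    qed
    then show "int p dvd ?u (nat (int p - e))" "int p dvd ?u (nat (int p - e) + 1) - 1"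
      by blast+
  qed
qed

text \<open>Since p divides both U and u_p - e, the norm relation between the neighbours u_p and U
  is linear in u_p - e modulo p^2.\<close>

lemma lucas_u_prime_cong_square:
  fixes p :: nat
  assumes "prime p" "odd p" "\<not> int p dvd A\<^sup>2 - 4"
  defines "e \<equiv> Legendre (A\<^sup>2 - 4) (int p)"
  defines "U \<equiv> lucas_u A 1 (nat (int p - e))"
  shows "[2 * lucas_u A 1 p = 2 * e + A * U] ( mod (int p)\<^sup>2)"
    and "[2 * (2 * lucas_u A 1 (p + 1) - A * lucas_u A 1 p) = 2 * A + e * (A\<^sup>2 - 4) * U] ( mod (int p)\<^sup>2)"
proof -
  let ?u = "lucas_u A 1"
  note rank = lucas_u_rank[OF assms(1-3), folded e_def, folded U_def]
  obtain y where y: "U = int p * y" using rank(2) by blast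
  obtain x where x: "?u p = e + int p * x"
    using cong_imp_ex[OF rank(4)] by blast
  have "e * e = 1" using rank(1) by auto
  \<comment> \<open>U is u_{p-1} or u_{p+1} according to the sign e; the factor e lets both cases
    share one formula.\<close>
  have v_norm: "2 * ?u (p + 1) - A * ?u p = e * (A * ?u p - 2 * U) \<and> (?u p)\<^sup>2 = 1 + A * ?u p * U - U\<^sup>2"
  proof (cases "e = 1")
    case True
    obtain k where k: "p = Suc k"
      using prime_gt_0_nat[OF assms(1)] by (cases p) auto
    have "U = ?u k" using True k by (simp add: U_def)
    then show ?thesis
      using True lucas_u_norm[of A k] k by (simp add: algebra_simps)
  next
    case False
    then have e: "e = -1" using rank(1) by simp
    then have U: "U = ?u (p + 1)"
      by (simp add: U_def nat_add_distrib)
    show ?thesis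
      using lucas_u_norm[of A p] unfolding e U by (simp add: algebra_simps)
  qed
  let ?P = "(int p)\<^sup>2"
  have "e * (e + int p * x)\<^sup>2 = e * (1 + A * (e + int p * x) * U - U\<^sup>2)"
    using v_norm unfolding x by simp
  moreover have "e * (e + int p * x)\<^sup>2 = (e * e) * e + 2 * (e * e) * (int p * x) + e * ?P * x\<^sup>2"
    by (simp add: algebra_simps power2_eq_square)
  moreover have "e * (1 + A * (e + int p * x) * U - U\<^sup>2) = e + (e * e) * A * U + e * ?P * (A * x * y - y\<^sup>2)"
    unfolding y by (simp add: algebra_simps power2_eq_square)
  ultimately have main: "2 * ?u p = 2 * e + A * U + ?P * (e * (A * x * y - y\<^sup>2 - x\<^sup>2))"
    unfolding x \<open>e * e = 1\<close> by (simp add: algebra_simps)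
  then show "[2 * ?u p = 2 * e + A * U] ( mod ?P)"
    by (simp add: cong_iff_dvd_diff)
  have "2 * (2 * ?u (p + 1) - A * ?u p) = e * (A * (2 * ?u p) - 4 * U)"
    using v_norm by simp
  also have "\<dots> = 2 * (e * e) * A + e * (A\<^sup>2 - 4) * U + ?P * ((e * e) * A * (A * x * y - y\<^sup>2 - x\<^sup>2))"
    unfolding main by (simp add: algebra_simps power2_eq_square)
  finally show "[2 * (2 * ?u (p + 1) - A * ?u p) = 2 * A + e * (A\<^sup>2 - 4) * U] ( mod ?P)"
    unfolding \<open>e * e = 1\<close> by (simp add: cong_iff_dvd_diff)
qed

text \<open>From p == e (mod p - e) follows p^(c+1) == e^c p modulo p (p - e), a period modulo p^2.
  So the index p^(c+1) acts as p or as -p, and passing to -p negates u and fixes the companion 2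
  u_{n+1} - A u_n.\<close>

lemma lucas_u_prime_power_cong_square:
  fixes p :: nat
  assumes "prime p" "odd p" "\<not> int p dvd A\<^sup>2 - 4"
  defines "e \<equiv> Legendre (A\<^sup>2 - 4) (int p)"
  shows "[lucas_u A 1 (p ^ Suc c) = e ^ c * lucas_u A 1 p] ( mod (int p)\<^sup>2)"
    and "[2 * lucas_u A 1 (p ^ Suc c + 1) - A * lucas_u A 1 (p ^ Suc c) = 2 * lucas_u A 1 (p + 1) - A * lucas_u A 1 p] ( mod (int p)\<^sup>2)"
proof -
  let ?u = "lucas_u A 1" and ?P = "(int p)\<^sup>2"
  define n where "n = nat (int p - e)"
  note rank = lucas_u_rank[OF assms(1-3), folded e_def, folded n_def]
  note period = lucas_u_period_cong_square[OF rank(2,3)]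
  have "p \<ge> 1" "p ^ c \<ge> 1" using assms(1) by (simp_all add: prime_gt_0_nat Suc_leI)
  have e_cases: "e = 1 \<or> e = -1" by (rule rank(1))
  have n: "int n = int p - e"
    using e_cases \<open>p \<ge> 1\<close> by (auto simp: n_def)
  have "[int p = e] ( mod int n)"
    by (simp add: n cong_iff_dvd_diff)
  then have "[int p ^ c = e ^ c] ( mod int n)"
    by (rule cong_pow)
  then have dvd: "int n dvd int p ^ c - e ^ c"
    by (simp add: cong_iff_dvd_diff)
  have "e ^ c = 1 \<or> e ^ c = -1"
    using e_cases by (induction c) auto
  then have "[?u (p ^ Suc c) = e ^ c * ?u p] ( mod ?P) \<and>
     [2 * ?u (p ^ Suc c + 1) - A * ?u (p ^ Suc c) = 2 * ?u (p + 1) - A * ?u p] ( mod ?P)"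
  proof
    assume ec: "e ^ c = 1"
    then have "int n dvd int (p ^ c - 1)"
      using dvd \<open>p ^ c \<ge> 1\<close> by (simp add: of_nat_diff)
    then obtain k where k: "p ^ c - 1 = n * k"
      unfolding of_nat_dvd_iff by blast
    have "p ^ Suc c = p + p * (p ^ c - 1)"
      using \<open>p ^ c \<ge> 1\<close> by (simp add: diff_mult_distrib2)
    then have q: "p ^ Suc c = p + (p * k) * n"
      using k by simp
    have "[?u (j + (p * k) * n) = ?u j] ( mod ?P)" for j
      by (intro lucas_u_add_period period) simp_all
    from this[of p] this[of "p + 1"] show ?thesis
      unfolding q ec by (auto intro!: cong_diff cong_scalar_left simp: add_ac)
  next
    assume ec: "e ^ c = -1"
    then have "int n dvd int (p ^ c + 1)"
      using dvd by (simp add: add.commute)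
    then obtain k where k: "p ^ c + 1 = n * k"
      unfolding of_nat_dvd_iff by blast
    have q: "p ^ Suc c + p = (p * k) * n"
    proof -
      have "p ^ Suc c + p = p * (p ^ c + 1)" by simp
      then show ?thesis unfolding k by (simp only: mult_ac)
    qed
    have "[?u (p ^ Suc c + p) = 0] ( mod ?P)" "[?u (p ^ Suc c + p + 1) = 1] ( mod ?P)"
      unfolding q by (intro period; simp)+
    note refl = lucas_u_reflect[OF this]
    have "[2 * ?u (p ^ Suc c + 1) - A * ?u (p ^ Suc c) = 2 * (?u (p + 1) - A * ?u p) - A * (- ?u p)] ( mod ?P)"
      by (intro cong_diff cong_scalar_left refl)
    then show ?thesis
      using refl(1) by (simp add: ec algebra_simps)
  qed
  then show "[?u (p ^ Suc c) = e ^ c * ?u p] ( mod ?P)"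
     "[2 * ?u (p ^ Suc c + 1) - A * ?u (p ^ Suc c) = 2 * ?u (p + 1) - A * ?u p] ( mod ?P)"
    by blast+
qed

section \<open>Expansion around m = 4\<close>

text \<open>At d = 0, u_n = n. The recurrence says that the second difference of u_{r+1} + u_r is d
  times its middle term, so the coefficient of d has second differences 2r + 3 = (r+2)^2 - (r+1)^2,
  as a sum of squares does.\<close>

lemma lucas_half_cong_linear:
  "[lucas_u (2 + d) 1 (r + 1) + lucas_u (2 + d) 1 r = int (2 * r + 1) + d * (\<Sum>i\<le>r. int i ^ 2)] ( mod d\<^sup>2)"
proof (induction r rule: induct_nat_012)
  case 1
  then show ?case by (simp add: cong_iff_dvd_diff numeral_2_eq_2)
next
  case (ge2 r)
  let ?u = "lucas_u (2 + d) 1" and ?s = "\<lambda>r. \<Sum>i\<le>r. int i ^ 2"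
  have "[(2 + d) * (?u (Suc r + 1) + ?u (Suc r)) - (?u (r + 1) + ?u r)
     = (2 + d) * (int (2 * Suc r + 1) + d * ?s (Suc r)) - (int (2 * r + 1) + d * ?s r)] ( mod d\<^sup>2)"
    using ge2 by (intro cong_diff cong_scalar_left)
  also have "(2 + d) * (int (2 * Suc r + 1) + d * ?s (Suc r)) - (int (2 * r + 1) + d * ?s r)
     = (int (2 * Suc (Suc r) + 1) + d * ?s (Suc (Suc r))) + d\<^sup>2 * ?s (Suc r)"
    by (simp add: algebra_simps power2_eq_square)
  also have "[\<dots> = int (2 * Suc (Suc r) + 1) + d * ?s (Suc (Suc r))] ( mod d\<^sup>2)"
    by (simp add: cong_iff_dvd_diff)
  finally show ?case by (simp add: algebra_simps)
qed simp

lemma lucas_u_cong_id: "[lucas_u (2 + d) 1 n = int n] ( mod d)"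
proof (induction n rule: induct_nat_012)
  case (ge2 n)
  have "[(2 + d) * lucas_u (2 + d) 1 (Suc n) - lucas_u (2 + d) 1 n = 2 * int (Suc n) - int n] ( mod d)"
    using ge2 by (intro cong_diff cong_mult) (simp_all add: cong_iff_dvd_diff)
  then show ?case by (simp add: add.commute)
qed simp_all

text \<open>Expressed through n = 2r + 1 and free of division, so that powers of p dividing n pass
  to the left side.\<close>

lemma sum_squares_24: "24 * (\<Sum>i\<le>r. int i ^ 2) = int (2 * r + 1) * ((int (2 * r + 1))\<^sup>2 - 1)"
  by (induction r) (simp_all add: algebra_simps power2_eq_square)

section \<open>The integer congruences\<close>

context
  fixes p a r :: nat and m :: int
  assumes p: "prime p" "odd p" and m: "\<not> int p dvd m" and r: "p ^ a = 2 * r + 1"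
begin

private abbreviation (input) "q \<equiv> p ^ a"
private abbreviation (input) "u \<equiv> lucas_u (m - 2) 1"
private abbreviation (input) "w \<equiv> u (r + 1) + u r"
private abbreviation (input) "X \<equiv> m ^ r * w"

private lemma discriminant: "(m - 2)\<^sup>2 - 4 = m * (m - 4)"
  by (simp add: algebra_simps power2_eq_square)

private lemma power_2r: "(b ^ r)\<^sup>2 = (b :: int) ^ (q - 1)"
  using r by (simp add: power_mult[symmetric] mult.commute)

lemma half_sum_cong_lucas: "[X = u q] ( mod int p)"
proof -
  have "[(\<Sum>k\<le>q. int (q choose k) * u (q - k)) = u (q - 0) + u (q - q)] ( mod int p)"
    by (rule sum_choose_ends[OF p(1)])
  then show ?thesis
    using sum_choose_lucas[of r m] r by simp
qed

lemma half_sum_cong_discriminant: "[X = (m * (m - 4)) ^ r] ( mod int p)"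
proof -
  have "[2 * u (0 + q) = (m * (m - 4)) ^ r * (2 * u (Suc 0) - (m - 2) * u 0) + (m - 2) * u 0] ( mod int p)"
    using lucas_u_prime_power_shift[OF p(1) r, of "m - 2" 0] unfolding discriminant .
  then have "[2 * u q = 2 * (m * (m - 4)) ^ r] ( mod int p ^ 1)"
    by (simp add: mult.commute)
  then have "[u q = (m * (m - 4)) ^ r] ( mod int p ^ 1)"
    by (rule cong_2_times_cancel[OF p(2)])
  with half_sum_cong_lucas show ?thesis
    using cong_trans by fastforce
qed

lemma sum_central_binomial_cong:
  "[(\<Sum>k<q. int (2 * k choose k) * m ^ (q - 1 - k)) = 2 * X - u q] ( mod (int p)\<^sup>2)"
proof -
  have q: "q > 0" using p by (simp add: prime_gt_0_nat)
  have split: "{..q} = insert 0 (insert q {0<..<q})" using q by auto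
  let ?S = "\<lambda>c. \<Sum>k\<in>{0<..<q}. c k * u (q - k)"
  have "(\<Sum>k\<le>q. int (2 * q choose k) * u (q - k)) = u q + ?S (\<lambda>k. int (2 * q choose k))"
    unfolding split using q by simp
  also have "[\<dots> = u q + ?S (\<lambda>k. 2 * int (q choose k))] ( mod (int p)\<^sup>2)"
    by (intro cong_add cong_sum cong_mult choose_double_prime_power_cong p) auto
  \<comment> \<open>The end k = 0 has coefficient 1, not 2, whence the correction - u q; the end k =
    q contributes nothing because u_0 = 0.\<close>
  also have "u q + ?S (\<lambda>k. 2 * int (q choose k)) = 2 * (\<Sum>k\<le>q. int (q choose k) * u (q - k)) - u q"
    unfolding split using q by (simp add: sum_distrib_left mult.assoc)
  also have "(\<Sum>k\<le>q. int (q choose k) * u (q - k)) = X"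
    using sum_choose_lucas[of r m] r by simp
  finally show ?thesis
    unfolding sum_central_binomial_eq_lucas .
qed

text \<open>The factor 4 keeps the second congruence integral: 2 (X - D^r), the value of T, involves
  m U / 2.\<close>

lemma half_sum_congs_nonzero:
  assumes "a > 0" and D: "\<not> int p dvd m * (m - 4)"
  defines "e \<equiv> Legendre (m * (m - 4)) (int p)"
  defines "U \<equiv> u (nat (int p - e))"
  shows "[2 * X - u q = (m ^ r)\<^sup>2 * (e ^ a + e ^ (a - 1) * U)] ( mod (int p)\<^sup>2)"
    and "[4 * (X - (m * (m - 4)) ^ r) = e ^ (a - 1) * m * U - 2 * e ^ a * ((m - 4) ^ (p - 1) - 1)] ( mod (int p)\<^sup>2)"
    and "int p dvd U"
proof -
  let ?P = "(int p)\<^sup>2"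
  obtain c where a: "a = Suc c" using \<open>a > 0\<close> by (cases a) auto
  have D': "\<not> int p dvd (m - 2)\<^sup>2 - 4" unfolding discriminant by (rule D)
  have m4: "\<not> int p dvd m - 4" using D by auto
  note rank = lucas_u_rank[OF p D', unfolded discriminant, folded e_def, folded U_def]
  note up = lucas_u_prime_cong_square[OF p D', unfolded discriminant, folded e_def, folded U_def]
  note uq = lucas_u_prime_power_cong_square[OF p D', of c, unfolded discriminant, folded e_def, folded a]
  define J where "J = e ^ c"
  define E where "E = e ^ a"
  have sq: "e\<^sup>2 = 1" "J\<^sup>2 = 1" "E\<^sup>2 = 1" "E = J * e"
    using rank(1) by (auto simp: J_def E_def a power2_eq_square power_mult_distrib[symmetric])
  show U: "int p dvd U" by (rule rank(2))
  obtain y where y: "U = int p * y" using U by blast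
  have "[2 * u q = 2 * (J * u p)] ( mod ?P)"
    unfolding J_def by (intro cong_scalar_left uq)
  also have "2 * (J * u p) = J * (2 * u p)" by simp
  also have "[J * (2 * u p) = J * (2 * e + (m - 2) * U)] ( mod ?P)"
    by (intro cong_scalar_left up)
  also have "J * (2 * e + (m - 2) * U) = 2 * E + J * (m - 2) * U"
    by (simp add: sq(4) algebra_simps)
  finally obtain t3 where t3: "2 * u q = 2 * E + J * (m - 2) * U + ?P * t3"
    using cong_imp_ex by blast
  have "[2 * ((m - 4) * w\<^sup>2 + 2) = 2 * (m - 2) + e * (m * (m - 4)) * U] ( mod ?P)"
    using cong_trans[OF cong_scalar_left[OF uq(2), of 2] up(2)] lucas_u_half_square[of "m - 2" r] r
    by simp
  then have "[2 * ((m - 4) * w\<^sup>2 + 2) - 4 = 2 * (m - 2) + e * (m * (m - 4)) * U - 4] ( mod ?P)"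
    by (rule cong_diff) simp
  then have "[(m - 4) * (2 * w\<^sup>2) = (m - 4) * (2 + e * m * U)] ( mod ?P)"
    by (simp add: algebra_simps)
  moreover have "coprime (m - 4) ?P"
    using m4 p(1) by (metis coprime_commute coprime_power_right_iff prime_imp_coprime prime_nat_int_transfer)
  ultimately have "[2 * w\<^sup>2 = 2 + e * m * U] ( mod ?P)"
    using cong_mult_lcancel by blast
  then obtain t2 where t2: "2 * w\<^sup>2 = 2 + e * m * U + ?P * t2"
    using cong_imp_ex by blast
  have "[u q = E] ( mod int p)"
  proof -
    have "[u q = J * u p] ( mod int p)"
      using uq(1) unfolding J_def by (rule cong_dvd_modulus) simp
    also have "[J * u p = J * e] ( mod int p)"
      by (intro cong_scalar_left rank)
    finally show ?thesis by (simp add: sq)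
  qed
  then have XE: "[X = E] ( mod int p)" and DE: "[(m * (m - 4)) ^ r = E] ( mod int p)"
    using half_sum_cong_lucas half_sum_cong_discriminant cong_trans cong_sym by blast+
  \<comment> \<open>Expand (z - E)^2 == 0 (mod p^2) and use E^2 = 1. This trades z, known only
    modulo p, for z^2.\<close>
  have square: "\<exists>t. 2 * z = E * (1 + z\<^sup>2) + ?P * t" if zE: "[z = E] ( mod int p)" for z
  proof -
    obtain s where s: "z = E + int p * s"
      using cong_imp_ex[OF zE] by blast
    have "E * (1 + z\<^sup>2) = E + E\<^sup>2 * E + 2 * E\<^sup>2 * (int p * s) + E * ?P * s\<^sup>2"
      unfolding s by (simp add: algebra_simps power2_eq_square)
    also have "\<dots> = 2 * z + ?P * (E * s\<^sup>2)"
      unfolding sq(3) s by simp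
    finally have "2 * z = E * (1 + z\<^sup>2) + ?P * (- E * s\<^sup>2)" by simp
    then show ?thesis by blast
  qed
  from square[OF XE] obtain t1 where t1: "2 * X = E * (1 + X\<^sup>2) + ?P * t1" by blast
  from square[OF DE] obtain t4 where t4: "2 * (m * (m - 4)) ^ r = E * (1 + ((m * (m - 4)) ^ r)\<^sup>2) + ?P * t4" by blast
  obtain n where n: "(m ^ r)\<^sup>2 = 1 + int p * n"
    using power_prime_power_minus_1_cong[OF p(1) m, of a] unfolding power_2r[symmetric]
    using cong_imp_ex by blast
  have K: "[((m - 4) ^ r)\<^sup>2 = (m - 4) ^ (p - 1)] ( mod ?P)"
    unfolding power_2r by (rule power_prime_power_minus_1_cong_square[OF p(1) m4 \<open>a > 0\<close>])
  obtain k where k: "((m - 4) ^ r)\<^sup>2 = 1 + int p * k"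
    using power_prime_power_minus_1_cong[OF p(1) m4, of a] unfolding power_2r[symmetric]
    using cong_imp_ex by blast
  have X2: "4 * X = 2 * E + E * (m ^ r)\<^sup>2 * (2 + e * m * U) + ?P * (2 * t1 + E * (m ^ r)\<^sup>2 * t2)"
  proof -
    have "4 * X = 2 * (2 * X)" by simp
    also have "\<dots> = 2 * E + E * (m ^ r)\<^sup>2 * (2 * w\<^sup>2) + 2 * ?P * t1"
      unfolding t1 unfolding power_mult_distrib by (simp add: algebra_simps)
    finally show ?thesis unfolding t2 by (simp add: algebra_simps)
  qed
  have Ee: "E * e = J" using sq(1) by (simp add: sq(4) power2_eq_square mult.assoc)
  have "2 * (2 * X - u q) - 2 * ((m ^ r)\<^sup>2 * (E + J * U))
      = ((E * e) * (m ^ r)\<^sup>2 * m - J * (m - 2) - 2 * J * (m ^ r)\<^sup>2) * U + ?P * (2 * t1 + E * (m ^ r)\<^sup>2 * t2 - t3)"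
  proof -
    have "2 * (2 * X - u q) = 4 * X - 2 * u q" by simp
    then show ?thesis unfolding X2 t3 by (simp add: algebra_simps)
  qed
  \<comment> \<open>If (m^r)^2 is replaced by 1, the bracket becomes J (m - (m-2) - 2) = 0. As
    (m^r)^2 == 1 (mod p), the bracket is a multiple of p, and so is U.\<close>
  also have "((E * e) * (m ^ r)\<^sup>2 * m - J * (m - 2) - 2 * J * (m ^ r)\<^sup>2) * U = ?P * (J * (m - 2) * n * y)"
    unfolding Ee n y by (simp add: algebra_simps power2_eq_square)
  finally have "?P dvd 2 * (2 * X - u q) - 2 * ((m ^ r)\<^sup>2 * (E + J * U))"
    by simp
  then have "[2 * (2 * X - u q) = 2 * ((m ^ r)\<^sup>2 * (E + J * U))] ( mod ?P)"
    by (simp add: cong_iff_dvd_diff)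
  then show "[2 * X - u q = (m ^ r)\<^sup>2 * (e ^ a + e ^ (a - 1) * U)] ( mod ?P)"
    using cong_2_times_cancel[OF p(2)] by (simp add: E_def J_def a)
  have "4 * (X - (m * (m - 4)) ^ r) = 4 * X - 2 * (2 * (m * (m - 4)) ^ r)" by simp
  also have "\<dots> = (m ^ r)\<^sup>2 * ((E * e) * m * U - 2 * E * (((m - 4) ^ r)\<^sup>2 - 1)) + ?P * (2 * t1 + E * (m ^ r)\<^sup>2 * t2 - 2 * t4)"
    unfolding X2 t4 unfolding power_mult_distrib by (simp add: algebra_simps)
  \<comment> \<open>The factor multiplying (m^r)^2 is divisible by p, so (m^r)^2 may be replaced by
    1.\<close>
  also have "\<dots> = (E * e) * m * U - 2 * E * (((m - 4) ^ r)\<^sup>2 - 1)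
     + ?P * (n * (E * e * m * y - 2 * E * k) + 2 * t1 + E * (m ^ r)\<^sup>2 * t2 - 2 * t4)"
    unfolding n k y by (simp add: algebra_simps power2_eq_square)
  finally have "[4 * (X - (m * (m - 4)) ^ r) = J * m * U - 2 * E * (((m - 4) ^ r)\<^sup>2 - 1)] ( mod ?P)"
    unfolding Ee by (simp add: cong_iff_dvd_diff)
  also have "[J * m * U - 2 * E * (((m - 4) ^ r)\<^sup>2 - 1) = J * m * U - 2 * E * ((m - 4) ^ (p - 1) - 1)] ( mod ?P)"
    by (intro cong_diff cong_scalar_left K cong_refl)
  finally show "[4 * (X - (m * (m - 4)) ^ r) = e ^ (a - 1) * m * U - 2 * e ^ a * ((m - 4) ^ (p - 1) - 1)] ( mod ?P)"
    by (simp add: E_def J_def a)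
qed

text \<open>Here u_n == n (mod p), so p divides w, and then X and u_q both agree with w modulo p^2.
  The power \<open>0 ^ (a - 1)\<close> is e^(a-1): it is 1 for a = 1, where w == u_p, while for a >=
  2 w itself vanishes modulo p^2.\<close>

lemma half_sum_congs_zero:
  assumes "a > 0" and D: "int p dvd m - 4"
  shows "[2 * X - u q = (m ^ r)\<^sup>2 * (0 ^ (a - 1) * u p)] ( mod (int p)\<^sup>2)"
    and "[4 * (X - (m * (m - 4)) ^ r) = 0 ^ (a - 1) * m * u p + (if q = 3 then 2 * (m - 4) else 0)] ( mod (int p)\<^sup>2)"
    and "int p dvd u p"
proof -
  let ?P = "(int p)\<^sup>2"
  obtain d where d: "m = 4 + int p * d" using D by (metis add.commute diff_add_cancel dvdE)
  have u_id: "[u n = int n] ( mod int p)" for n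
  proof -
    have "[u n = int n] ( mod m - 4)"
      using lucas_u_cong_id[of "m - 4" n] by (simp add: algebra_simps)
    then show ?thesis using D cong_dvd_modulus by blast
  qed
  show up: "int p dvd u p"
    using cong_dvd_iff[OF u_id[of p]] by simp
  have "[w = int (2 * r + 1)] ( mod int p)"
    using cong_add[OF u_id[of "r + 1"] u_id[of r]] by (simp add: algebra_simps)
  moreover have "int p dvd int (2 * r + 1)"
    unfolding r[symmetric] using \<open>a > 0\<close> by simp
  ultimately have wp: "int p dvd w"
    using cong_dvd_iff by blast
  then obtain s where s: "w = int p * s" by blast
  have "[u (r + 1) - u r = 1] ( mod int p)"
    using cong_diff[OF u_id[of "r + 1"] u_id[of r]] by simp
  then obtain t where t: "u (r + 1) - u r = 1 + int p * t"
    using cong_imp_ex by blast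
  have "u q = w * (u (r + 1) - u r)"
    using lucas_u_add[of "m - 2" r r] unfolding r mult_2 by (simp add: algebra_simps)
  then have "u q = w + ?P * (s * t)"
    unfolding t s by (simp add: algebra_simps power2_eq_square)
  then have uq: "[u q = w] ( mod ?P)"
    by (simp add: cong_iff_dvd_diff)
  have "p \<ge> 3" using p prime_ge_2_nat[of p] by (cases "p = 2") auto
  have mr: "[m ^ r = 1] ( mod int p)"
  proof -
    have "[m ^ r = 4 ^ r] ( mod int p)"
      using D by (intro cong_pow) (simp add: cong_iff_dvd_diff)
    also have "(4::int) ^ r = (2 ^ r)\<^sup>2"
      by (simp add: power2_eq_square flip: power_mult_distrib)
    also have "[(2 ^ r)\<^sup>2 = 1] ( mod int p)"
      unfolding power_2r
      by (rule power_prime_power_minus_1_cong[OF p(1)]) (use \<open>p \<ge> 3\<close> zdvd_not_zless[of 2 "int p"] in auto)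
    finally show ?thesis .
  qed
  have absorb: "[c * z = z] ( mod ?P)" if "[c = 1] ( mod int p)" "int p dvd z" for c z
  proof -
    have "?P dvd (c - 1) * z"
      unfolding power2_eq_square using that by (intro mult_dvd_mono) (simp_all add: cong_iff_dvd_diff)
    then show ?thesis by (simp add: cong_iff_dvd_diff algebra_simps)
  qed
  have X: "[X = w] ( mod ?P)" by (rule absorb[OF mr wp])
  have mr2: "[(m ^ r)\<^sup>2 = 1] ( mod int p)"
    using cong_pow[OF mr, of 2] by simp
  have "[2 * X - u q = 2 * w - w] ( mod ?P)"
    by (intro cong_diff cong_scalar_left X uq)
  then have 1: "[2 * X - u q = w] ( mod ?P)" by simp
  have r2: "?P dvd (m * (m - 4)) ^ r" if "r \<ge> 2"
  proof -
    have "(m - 4)\<^sup>2 dvd (m * (m - 4)) ^ r"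
      using that unfolding power_mult_distrib by (intro dvd_mult le_imp_power_dvd)
    moreover have "?P dvd (m - 4)\<^sup>2" using D by (simp add: dvd_power_same)
    ultimately show ?thesis using dvd_trans by blast
  qed
  have "[2 * X - u q = (m ^ r)\<^sup>2 * (0 ^ (a - 1) * u p)] ( mod ?P)
    \<and> [4 * (X - (m * (m - 4)) ^ r) = 0 ^ (a - 1) * m * u p + (if q = 3 then 2 * (m - 4) else 0)] ( mod ?P)"
  proof (cases "a = 1")
    case True
    have w: "[w = u p] ( mod ?P)" using uq True by (simp add: cong_sym)
    have *: "[(m ^ r)\<^sup>2 * u p = u p] ( mod ?P)" by (rule absorb[OF mr2 up])
    have mu: "[4 * u p = m * u p] ( mod ?P)"
    proof -
      have "?P dvd (m - 4) * u p"
        unfolding power2_eq_square using D up by (rule mult_dvd_mono)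
      then have "[m * u p = 4 * u p] ( mod ?P)"
        by (simp add: cong_iff_dvd_diff left_diff_distrib)
      then show ?thesis by (rule cong_sym)
    qed
    have XU: "[4 * X = m * u p] ( mod ?P)"
      using cong_trans[OF cong_scalar_left[OF cong_trans[OF X w], of 4] mu] .
    have "[- 4 * (m * (m - 4)) ^ r = (if q = 3 then 2 * (m - 4) else 0)] ( mod ?P)"
    proof (cases "p = 3")
      case p3: True
      then have "r = 1" using r True by simp
      \<comment> \<open>With r = 1 the prime 3 need divide D^r only once. From m == 1 (mod 3) one
        gets -4 m == 2 (mod 3), and m - 4 supplies the second factor 3.\<close>
      have "-4 * (m * (m - 4)) - 2 * (m - 4) = 9 * (-2 * d * (3 + 2 * d))"
      proof -
        have "m = 4 + 3 * d" using d p3 by simp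
        then show ?thesis by (simp add: algebra_simps)
      qed
      then have "9 dvd -4 * (m * (m - 4)) - 2 * (m - 4)" by (metis dvd_triv_left)
      then show ?thesis using p3 True \<open>r = 1\<close> by (simp add: cong_iff_dvd_diff)
    next
      case False
      then have "r \<ge> 2" using r True \<open>p \<ge> 3\<close> p(2) by (cases "p = 4") auto
      then show ?thesis using False r2 True by (simp add: cong_iff_dvd_diff)
    qed
    with XU have "[4 * X + (- 4 * (m * (m - 4)) ^ r) = m * u p + (if q = 3 then 2 * (m - 4) else 0)] ( mod ?P)"
      by (rule cong_add)
    then show ?thesis
      using True cong_trans[OF cong_trans[OF 1 w] cong_sym[OF *]] by (simp add: algebra_simps)
  next
    case False
    then have "a \<ge> 2" using \<open>a > 0\<close> by simp
    then have "p\<^sup>2 dvd q" by (simp add: le_imp_power_dvd)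
    then have Pq: "?P dvd int (2 * r + 1)"
      unfolding r[symmetric] by (metis of_nat_dvd_iff of_nat_power)
    have "9 \<le> p\<^sup>2" using power_mono[OF \<open>p \<ge> 3\<close>, of 2] by simp
    also have "\<dots> \<le> q" using \<open>p\<^sup>2 dvd q\<close> r by (simp add: dvd_imp_le)
    finally have "q \<ge> 9" .
    then have "r \<ge> 2" using r by simp
    let ?c = "\<Sum>i\<le>r. int i ^ 2"
    have "[u (r + 1) + u r = int (2 * r + 1) + (m - 4) * ?c] ( mod (m - 4)\<^sup>2)"
      using lucas_half_cong_linear[of "m - 4" r] by (simp add: algebra_simps)
    then have lin: "[w = int (2 * r + 1) + (m - 4) * ?c] ( mod ?P)"
      using D cong_dvd_modulus dvd_power_same by blast
    have "int p dvd ?c"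
    proof -
      \<comment> \<open>The square of p matters at p = 3, where 24 absorbs one factor.\<close>
      have P24: "?P dvd 24 * ?c"
        unfolding sum_squares_24 using Pq by simp
      show ?thesis
      proof (cases "p = 3")
        case True
        have "3 dvd c" if "9 dvd 24 * c" for c :: int
          using that by presburger
        then show ?thesis using P24 True by simp
      next
        case False
        have "int p dvd 24 * ?c" using P24 by (metis dvd_mult_left power2_eq_square)
        moreover have "coprime (int p) 24"
        proof -
          have "prime (3 :: nat)" by simp
          then have "coprime p 3" "coprime p 2"
            using False p primes_coprime[of p 3] primes_coprime[of p 2] by auto
          then have "coprime p (2 ^ 3 * 3)"
            by (simp only: coprime_mult_right_iff coprime_power_right_iff simp_thms)
          then have "coprime (int p) (int (2 ^ 3 * 3))" by (simp only: coprime_int_iff)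
          then show ?thesis by simp
        qed
        ultimately show ?thesis by (simp add: coprime_dvd_mult_right_iff)
      qed
    qed
    then have "?P dvd (m - 4) * ?c"
      unfolding power2_eq_square using D by (rule mult_dvd_mono[rotated])
    then have "?P dvd w"
      using cong_dvd_iff[OF lin] Pq by (simp only: dvd_add)
    then have "[w = 0] ( mod ?P)" by (simp add: cong_0_iff)
    then have "[2 * X - u q = 0] ( mod ?P)" and X0: "[X = 0] ( mod ?P)"
      using 1 X cong_trans by blast+
    moreover have "[4 * (X - (m * (m - 4)) ^ r) = 4 * (0 - 0)] ( mod ?P)"
      using r2[OF \<open>r \<ge> 2\<close>] by (intro cong_diff cong_scalar_left X0) (simp add: cong_0_iff)
    ultimately show ?thesis
      using \<open>a \<ge> 2\<close> \<open>q \<ge> 9\<close> by (simp add: zero_power)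
  qed
  then show "[2 * X - u q = (m ^ r)\<^sup>2 * (0 ^ (a - 1) * u p)] ( mod ?P)"
    and "[4 * (X - (m * (m - 4)) ^ r) = 0 ^ (a - 1) * m * u p + (if q = 3 then 2 * (m - 4) else 0)] ( mod ?P)"
    by blast+
qed

text \<open>For q = 3, m - 1 and m - 4 agree modulo 3, so the exceptional condition on m is
  precisely that p divides m - 4.\<close>

lemma half_sum_congs:
  assumes "a > 0"
  defines "e \<equiv> Legendre (m * (m - 4)) (int p)"
  defines "U \<equiv> u (nat (int p - e))"
  shows "[2 * X - u q = (m ^ r)\<^sup>2 * (e ^ a + e ^ (a - 1) * U)] ( mod (int p)\<^sup>2)"
    and "[4 * (X - (m * (m - 4)) ^ r) = e ^ (a - 1) * m * U - 2 * e ^ a * ((m - 4) ^ (p - 1) - 1)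
        + (if q = 3 \<and> 3 dvd m - 1 then 2 * (m - 4) else 0)] ( mod (int p)\<^sup>2)"
    and "int p dvd U"
proof -
  have q3: "p = 3" if "q = 3"
  proof -
    have "p dvd q" using \<open>a > 0\<close> by simp
    moreover have "prime (3 :: nat)" by simp
    ultimately show ?thesis using that p(1) primes_dvd_imp_eq[of p 3] by simp
  qed
  have "[2 * X - u q = (m ^ r)\<^sup>2 * (e ^ a + e ^ (a - 1) * U)] ( mod (int p)\<^sup>2)
   \<and> [4 * (X - (m * (m - 4)) ^ r) = e ^ (a - 1) * m * U - 2 * e ^ a * ((m - 4) ^ (p - 1) - 1)
        + (if q = 3 \<and> 3 dvd m - 1 then 2 * (m - 4) else 0)] ( mod (int p)\<^sup>2) \<and> int p dvd U"
  proof (cases "int p dvd m - 4")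
    case True
    then have "e = 0" by (simp add: e_def Legendre_def cong_0_iff)
    moreover have "3 dvd m - 1" if "q = 3"
      using True q3[OF that] by simp presburger
    ultimately show ?thesis
      using half_sum_congs_zero[OF \<open>a > 0\<close> True] \<open>a > 0\<close> by (auto simp: U_def zero_power)
  next
    case False
    then have "\<not> int p dvd m * (m - 4)"
      using p(1) m by (simp add: prime_dvd_mult_iff)
    moreover have "\<not> (q = 3 \<and> 3 dvd m - 1)"
      using False q3 by auto presburger
    ultimately show ?thesis
      using half_sum_congs_nonzero[OF \<open>a > 0\<close>] unfolding e_def U_def by auto
  qed
  then show "[2 * X - u q = (m ^ r)\<^sup>2 * (e ^ a + e ^ (a - 1) * U)] ( mod (int p)\<^sup>2)"
    and "[4 * (X - (m * (m - 4)) ^ r) = e ^ (a - 1) * m * U - 2 * e ^ a * ((m - 4) ^ (p - 1) - 1)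
        + (if q = 3 \<and> 3 dvd m - 1 then 2 * (m - 4) else 0)] ( mod (int p)\<^sup>2)"
    and "int p dvd U"
    by blast+
qed

end

section \<open>Congruences over the localization at a prime\<close>

text \<open>Both sides satisfy F(n+1) = (1+x) F(n) + ((1+x)^(n+1) - 1) / (n+1). On the left the last
  term comes from C(n,k) / (k+1) = C(n+1,k+1) / (n+1); on the right it is the new summand j = n +
  1.\<close>

lemma sum_choose_harmonic:
  fixes x :: "'a::field_char_0"
  shows "(\<Sum>k\<le>n. of_nat (n choose k) * ((\<Sum>j=1..k. 1 / of_nat j) * x ^ k))
    = (\<Sum>j=1..n. ((1 + x) ^ n - (1 + x) ^ (n - j)) / of_nat j)"
proof (induction n)
  case (Suc n)
  let ?H = "\<lambda>k. \<Sum>j=1..k. 1 / of_nat j :: 'a" and ?y = "1 + x"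
  have nz: "of_nat (Suc n) \<noteq> (0 :: 'a)" by (simp only: of_nat_eq_0_iff)
  have "(\<Sum>k\<le>n. of_nat (n choose k) * (x ^ Suc k / of_nat (Suc k)))
      = (\<Sum>k\<le>n. of_nat (Suc n choose Suc k) * x ^ Suc k / of_nat (Suc n))"
  proof (intro sum.cong refl)
    fix k
    have "of_nat (Suc k) * of_nat (Suc n choose Suc k) = (of_nat (Suc n) * of_nat (n choose k) :: 'a)"
      by (simp only: Suc_times_binomial of_nat_mult[symmetric])
    moreover have "of_nat (Suc k) \<noteq> (0 :: 'a)" by (simp only: of_nat_eq_0_iff)
    ultimately show "of_nat (n choose k) * (x ^ Suc k / of_nat (Suc k))
        = of_nat (Suc n choose Suc k) * x ^ Suc k / (of_nat (Suc n) :: 'a)"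
      using nz by (simp add: field_simps del: of_nat_Suc binomial_Suc_Suc)
  qed
  also have "\<dots> = (\<Sum>k\<le>n. of_nat (Suc n choose Suc k) * x ^ Suc k) / of_nat (Suc n)"
    by (simp only: sum_divide_distrib)
  also have "(\<Sum>k\<le>n. of_nat (Suc n choose Suc k) * x ^ Suc k) = ?y ^ Suc n - 1"
  proof -
    have "(x + 1) ^ Suc n = 1 + (\<Sum>k\<le>n. of_nat (Suc n choose Suc k) * x ^ Suc k)"
      unfolding binomial_ring by (subst sum.atMost_Suc_shift) (simp del: binomial_Suc_Suc)
    then show ?thesis by (simp add: add.commute)
  qed
  finally have int: "(\<Sum>k\<le>n. of_nat (n choose k) * (x ^ Suc k / of_nat (Suc k))) = (?y ^ Suc n - 1) / of_nat (Suc n)" .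
  have "(\<Sum>k\<le>Suc n. of_nat (Suc n choose k) * (?H k * x ^ k))
      = (\<Sum>k\<le>n. of_nat (n choose k) * (?H k * x ^ k)) + (\<Sum>k\<le>n. of_nat (n choose k) * (?H (Suc k) * x ^ Suc k))"
    by (rule sum_choose_Suc)
  also have "(\<Sum>k\<le>n. of_nat (n choose k) * (?H (Suc k) * x ^ Suc k))
     = x * (\<Sum>k\<le>n. of_nat (n choose k) * (?H k * x ^ k)) + (\<Sum>k\<le>n. of_nat (n choose k) * (x ^ Suc k / of_nat (Suc k)))"
    unfolding sum_distrib_left sum.distrib[symmetric]
    by (intro sum.cong refl) (simp add: algebra_simps)
  also have "(\<Sum>k\<le>n. of_nat (n choose k) * (?H k * x ^ k)) + (x * (\<Sum>k\<le>n. of_nat (n choose k) * (?H k * x ^ k))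
      + (\<Sum>k\<le>n. of_nat (n choose k) * (x ^ Suc k / of_nat (Suc k))))
     = ?y * (\<Sum>j=1..n. (?y ^ n - ?y ^ (n - j)) / of_nat j) + (?y ^ Suc n - 1) / of_nat (Suc n)"
    unfolding int Suc.IH by (simp add: distrib_right)
  also have "?y * (\<Sum>j=1..n. (?y ^ n - ?y ^ (n - j)) / of_nat j)
     = (\<Sum>j=1..n. (?y ^ Suc n - ?y ^ (Suc n - j)) / of_nat j)"
    unfolding sum_distrib_left
    by (intro sum.cong refl) (simp add: Suc_diff_le right_diff_distrib)
  finally show ?case by simp
qed simp

text \<open>
  The assumptions say that \<open>R\<close> is a subring containing the localization of the integers at \<open>p\<close>.
\<close>

locale p_integers =
  fixes p :: nat and R :: "'a::field_char_0 set"
  assumes prime: "prime p"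
    and one_closed: "1 \<in> R"
    and diff_closed: "\<lbrakk>x \<in> R; y \<in> R\<rbrakk> \<Longrightarrow> x - y \<in> R"
    and mult_closed: "\<lbrakk>x \<in> R; y \<in> R\<rbrakk> \<Longrightarrow> x * y \<in> R"
    and inverse_closed: "\<not> int p dvd m \<Longrightarrow> inverse (of_int m) \<in> R"
begin

section \<open>Arithmetic modulo powers of p in R\<close>

definition ideal :: "nat \<Rightarrow> 'a set"
  where "ideal n = (\<lambda>z. of_nat p ^ n * z) ` R"

lemma zero_closed: "0 \<in> R"
  using diff_closed[OF one_closed one_closed] by simp

lemma uminus_closed: "x \<in> R \<Longrightarrow> - x \<in> R"
  using diff_closed[OF zero_closed] by simp

lemma add_closed: "\<lbrakk>x \<in> R; y \<in> R\<rbrakk> \<Longrightarrow> x + y \<in> R"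
  using diff_closed[OF _ uminus_closed] by simp

lemma sum_closed: "(\<And>i. i \<in> A \<Longrightarrow> f i \<in> R) \<Longrightarrow> sum f A \<in> R"
  by (induction A rule: infinite_finite_induct) (simp_all add: zero_closed add_closed)

lemma power_closed: "x \<in> R \<Longrightarrow> x ^ n \<in> R"
  by (induction n) (simp_all add: one_closed mult_closed)

lemma of_nat_closed: "of_nat n \<in> R"
  by (induction n) (simp_all add: zero_closed one_closed add_closed)

lemma of_int_closed: "of_int z \<in> R"
  by (cases z) (simp_all add: of_nat_closed uminus_closed del: of_nat_Suc)

lemma divide_closed: "\<lbrakk>x \<in> R; \<not> int p dvd m\<rbrakk> \<Longrightarrow> x / of_int m \<in> R"
  by (simp add: divide_inverse inverse_closed mult_closed)

lemma ideal_0: "ideal 0 = R"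
  by (simp add: ideal_def)

lemma ideal_zero: "0 \<in> ideal n"
  unfolding ideal_def using zero_closed by force

lemma ideal_diff: "\<lbrakk>x \<in> ideal n; y \<in> ideal n\<rbrakk> \<Longrightarrow> x - y \<in> ideal n"
  unfolding ideal_def by (auto simp flip: right_diff_distrib intro: diff_closed)

lemma ideal_uminus: "x \<in> ideal n \<Longrightarrow> - x \<in> ideal n"
  using ideal_diff[OF ideal_zero] by simp

lemma ideal_add: "\<lbrakk>x \<in> ideal n; y \<in> ideal n\<rbrakk> \<Longrightarrow> x + y \<in> ideal n"
  using ideal_diff[OF _ ideal_uminus] by simp

lemma ideal_trans: "\<lbrakk>x - y \<in> ideal n; y - z \<in> ideal n\<rbrakk> \<Longrightarrow> x - z \<in> ideal n"
  using ideal_add[of "x - y" n "y - z"] by simp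

lemma ideal_sum: "(\<And>i. i \<in> A \<Longrightarrow> f i \<in> ideal n) \<Longrightarrow> sum f A \<in> ideal n"
  by (induction A rule: infinite_finite_induct) (simp_all add: ideal_zero ideal_add)

lemma ideal_mult: "\<lbrakk>x \<in> ideal k; y \<in> ideal n\<rbrakk> \<Longrightarrow> x * y \<in> ideal (k + n)"
  unfolding ideal_def
  by (auto simp: power_add mult_ac intro!: image_eqI[OF _ mult_closed])

lemma ideal_mult_left: "\<lbrakk>x \<in> R; y \<in> ideal n\<rbrakk> \<Longrightarrow> x * y \<in> ideal n"
  using ideal_mult[of x 0 y n] by (simp add: ideal_0)

lemma ideal_mult_right: "\<lbrakk>x \<in> ideal n; y \<in> R\<rbrakk> \<Longrightarrow> x * y \<in> ideal n"
  using ideal_mult_left[of y x] by (simp add: mult.commute)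

lemma ideal_mult_1: "\<lbrakk>x \<in> ideal 1; y \<in> ideal 1\<rbrakk> \<Longrightarrow> x * y \<in> ideal 2"
  using ideal_mult[of x 1 y 1] by (simp add: numeral_2_eq_2)

lemma ideal_subset: "ideal n \<subseteq> R"
  unfolding ideal_def by (auto intro: mult_closed power_closed of_nat_closed)

lemma ideal_antimono: "k \<le> n \<Longrightarrow> ideal n \<subseteq> ideal k"
proof
  fix x assume "k \<le> n" "x \<in> ideal n"
  then obtain z where z: "z \<in> R" "x = of_nat p ^ k * (of_nat p ^ (n - k) * z)"
    by (auto simp: ideal_def simp flip: mult.assoc power_add)
  then show "x \<in> ideal k"
    unfolding ideal_def by (auto intro: mult_closed power_closed of_nat_closed)
qed

lemma of_int_in_ideal:
  assumes "int p ^ n dvd z"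
  shows "of_int z \<in> ideal n"
proof -
  obtain t where "z = int p ^ n * t" using assms by blast
  then have "of_int z = of_nat p ^ n * (of_int t :: 'a)" by simp
  then show ?thesis unfolding ideal_def using of_int_closed by blast
qed

lemma cong_in_ideal:
  assumes "[x = y] ( mod int p ^ n)"
  shows "of_int x - of_int y \<in> ideal n"
  using of_int_in_ideal[of n "x - y"] assms by (simp add: cong_iff_dvd_diff)

lemma ideal_cancel_unit:
  assumes "\<not> int p dvd m" "of_int m * x \<in> ideal n"
  shows "x \<in> ideal n"
proof -
  have "of_int m \<noteq> (0 :: 'a)" using assms(1) by auto
  moreover have "inverse (of_int m) * (of_int m * x) \<in> ideal n"
    by (rule ideal_mult_left[OF inverse_closed[OF assms(1)] assms(2)])
  ultimately show ?thesis by (simp add: mult.assoc[symmetric])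
qed

section \<open>Binomial coefficients modulo p and modulo p^2 in R\<close>

lemma prime_power_over_less_in_ideal:
  assumes "0 < j" "j < p ^ a"
  shows "of_nat p ^ a / of_nat j \<in> ideal 1"
proof -
  have "\<not> is_unit p" using prime not_prime_unit by blast
  then obtain j' where j': "j = p ^ multiplicity p j * j'" "\<not> p dvd j'"
    using assms(1) by (metis multiplicity_decompose' neq0_conv)
  define b where "b = multiplicity p j"
  have j: "j = p ^ b * j'" using j' by (simp add: b_def)
  then have "p ^ b dvd j" by simp
  then have "p ^ b < p ^ a" using assms dvd_imp_le le_less_trans by blast
  then have "b < a"
    using prime by (simp add: prime_gt_Suc_0_nat)
  \<comment> \<open>Because b < a, division of p^a by p^b leaves one factor p for the ideal and c
    further ones.\<close>
  define c where "c = a - b - 1"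
  have a: "a = Suc (b + c)" using \<open>b < a\<close> by (simp add: c_def)
  have "of_nat p \<noteq> (0 :: 'a)" using prime by auto
  then have "of_nat p ^ a / of_nat j = of_nat p ^ 1 * (of_nat p ^ c / of_int (int j') :: 'a)"
    unfolding j a by (simp add: power_add)
  moreover have "of_nat p ^ c / of_int (int j') \<in> R"
    using j'(2) by (intro divide_closed power_closed of_nat_closed) simp
  ultimately show ?thesis unfolding ideal_def by blast
qed

lemma prime_power_harmonic_in_ideal:
  assumes "k < p ^ a"
  shows "of_nat p ^ a * (\<Sum>j=1..k. 1 / of_nat j) \<in> ideal 1"
  unfolding sum_distrib_left
proof (rule ideal_sum)
  fix j assume "j \<in> {1..k}"
  then show "of_nat p ^ a * (1 / of_nat j) \<in> ideal 1"
    using prime_power_over_less_in_ideal[of j a] assms by simp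
qed

text \<open>The binomial is (-1)^k times the product of the factors 1 - h q / j for j = 1, ..., k;
  each h q / j lies in \<open>ideal 1\<close>, so only the linear terms survive.\<close>

lemma gbinomial_prime_power_cong:
  assumes "k < p ^ a" "h \<in> R"
  shows "((h * of_nat p ^ a - 1) gchoose k) - (- 1) ^ k * (1 - h * (of_nat p ^ a * (\<Sum>j=1..k. 1 / of_nat j))) \<in> ideal 2"
  using assms(1)
proof (induction k)
  case 0
  then show ?case by (simp add: ideal_zero)
next
  case (Suc k)
  let ?g = "\<lambda>k. (h * of_nat p ^ a - 1) gchoose k" and ?H = "\<lambda>k. \<Sum>j=1..k. 1 / of_nat j :: 'a"
  let ?Q = "of_nat p ^ a :: 'a" and ?t = "h * (of_nat p ^ a / of_nat (Suc k))"
  let ?E = "?g k - (- 1) ^ k * (1 - h * (?Q * ?H k))"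
  have nz: "of_nat (Suc k) \<noteq> (0 :: 'a)" by (simp only: of_nat_eq_0_iff)
  have "of_nat (Suc k) * ?g (Suc k) = (h * ?Q - 1 - of_nat k) * ?g k"
    using gbinomial_mult_1[of "h * ?Q - 1" k] by (simp add: algebra_simps)
  then have g: "?g (Suc k) = - (1 - ?t) * ?g k"
    using nz by (simp add: field_simps)
  have H: "h * (?Q * ?H (Suc k)) = h * (?Q * ?H k) + ?t"
    by (simp add: algebra_simps)
  have t: "?t \<in> ideal 1"
    using Suc.prems by (intro ideal_mult_left prime_power_over_less_in_ideal assms(2)) auto
  have QH: "h * (?Q * ?H k) \<in> ideal 1"
    using Suc.prems by (intro ideal_mult_left prime_power_harmonic_in_ideal assms(2)) auto
  have "?g (Suc k) - (- 1) ^ Suc k * (1 - h * (?Q * ?H (Suc k)))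
      = - (1 - ?t) * ?E - (- 1) ^ k * (?t * (h * (?Q * ?H k)))"
    unfolding g H by (simp add: algebra_simps)
  moreover have "- (1 - ?t) * ?E \<in> ideal 2"
    using Suc.prems ideal_subset t
    by (intro ideal_mult_left Suc.IH uminus_closed diff_closed one_closed) auto
  moreover have "(- 1) ^ k * (?t * (h * (?Q * ?H k))) \<in> ideal 2"
    by (intro ideal_mult_left power_closed uminus_closed one_closed ideal_mult_1 t QH)
  ultimately show ?case using ideal_diff by simp
qed

text \<open>C(q,i) = (q/i) C(q-1,i-1). As q/i lies in \<open>ideal 1\<close>, the second factor is
  needed only modulo p, which is the case h = 1 of the preceding congruence.\<close>

lemma choose_prime_power_cong:
  assumes "0 < i" "i < p ^ a"
  shows "of_nat (p ^ a choose i) - (- 1) ^ (i - 1) * (of_nat p ^ a / of_nat i) \<in> ideal 2"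
proof -
  let ?q = "p ^ a" and ?H = "\<Sum>j=1..i - 1. 1 / of_nat j :: 'a"
  have nz: "of_nat i \<noteq> (0 :: 'a)" using assms(1) by simp
  have "of_nat i * of_nat (?q choose i) = (of_nat ?q * of_nat (?q - 1 choose (i - 1)) :: 'a)"
    unfolding of_nat_mult[symmetric] times_binomial_minus1_eq[OF assms(1)] ..
  then have C: "of_nat (?q choose i) = (of_nat p ^ a / of_nat i) * (of_nat (?q - 1 choose (i - 1)) :: 'a)"
    using nz by (simp add: field_simps)
  have "of_nat (?q - 1 choose (i - 1)) = ((1 * of_nat p ^ a - 1) gchoose (i - 1) :: 'a)"
    using assms by (simp add: binomial_gbinomial of_nat_diff Suc_leI)
  then have "of_nat (?q - 1 choose (i - 1)) - (- 1) ^ (i - 1) * (1 - 1 * (of_nat p ^ a * ?H)) \<in> ideal 2"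
    using gbinomial_prime_power_cong[of "i - 1" a 1] assms one_closed by simp
  then have "of_nat (?q - 1 choose (i - 1)) - (- 1) ^ (i - 1) * (1 - 1 * (of_nat p ^ a * ?H)) \<in> ideal 1"
    using ideal_antimono[of 1 2] by auto
  moreover have "(- 1) ^ (i - 1) * (of_nat p ^ a * ?H) \<in> ideal 1"
    using assms by (intro ideal_mult_left power_closed uminus_closed one_closed prime_power_harmonic_in_ideal) auto
  ultimately have "of_nat (?q - 1 choose (i - 1)) - (- 1) ^ (i - 1) * (1 - 1 * (of_nat p ^ a * ?H))
      - (- 1) ^ (i - 1) * (of_nat p ^ a * ?H) \<in> ideal 1"
    by (rule ideal_diff)
  then have "of_nat (?q - 1 choose (i - 1)) - (- 1) ^ (i - 1) \<in> ideal 1"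
    by (simp add: algebra_simps)
  then have "(of_nat p ^ a / of_nat i) * (of_nat (?q - 1 choose (i - 1)) - (- 1) ^ (i - 1)) \<in> ideal 2"
    using assms by (intro ideal_mult_1 prime_power_over_less_in_ideal)
  then show ?thesis unfolding C by (simp add: algebra_simps)
qed

text \<open>C(2k,k) = (-4)^k C(-1/2,k), and r = (q-1)/2 is close to -1/2. The step from k to k + 1
  divides by k + 1, which p may divide and which would spoil an additive error; hence for k \<le> r
  the two sides are compared through a factor 1 + e. The quotient of their steps is 1 - q /
  (2k+1).\<close>

lemma central_binomial_cong_half:
  assumes r: "p ^ a = 2 * r + 1" and k: "k < p ^ a"
  shows "of_nat (2 * k choose k) - of_nat (r choose k) * (- 4) ^ k \<in> ideal 1"
proof (cases "k \<le> r")
  case False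
  then have "p ^ a \<le> 2 * k" using r by simp
  then have "p dvd 2 * k choose k"
    using central_binomial_cong_0[OF prime k] by simp
  then have "of_int (int (2 * k choose k)) \<in> ideal 1"
    by (intro of_int_in_ideal) simp
  then show ?thesis using False by (simp add: binomial_eq_0)
next
  case True
  then have "\<exists>e\<in>ideal 1. of_nat (2 * k choose k) * (1 + e) = of_nat (r choose k) * (- 4) ^ k"
  proof (induction k)
    case 0
    then show ?case using ideal_zero by force
  next
    case (Suc k)
    then obtain e where e: "e \<in> ideal 1" "of_nat (2 * k choose k) * (1 + e) = of_nat (r choose k) * (- 4) ^ k"
      by auto
    let ?t = "of_nat p ^ a / of_nat (2 * k + 1) :: 'a"
    have t: "?t \<in> ideal 1"
      using Suc.prems r by (intro prime_power_over_less_in_ideal) auto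
    have nz: "of_nat (Suc k) \<noteq> (0 :: 'a)" "of_nat (2 * k + 1) \<noteq> (0 :: 'a)"
      by (simp_all only: of_nat_eq_0_iff)
    have "Suc k * (2 * Suc k choose Suc k) = 2 * (2 * k + 1) * (2 * k choose k)"
    proof -
      have "Suc (2 * k) - k = Suc k" by simp
      then have "Suc (2 * k) choose k = Suc (2 * k) choose Suc k"
        using binomial_symmetric[of k "Suc (2 * k)"] by (simp del: binomial_Suc_Suc)
      then have "Suc k * (2 * Suc k choose Suc k) = 2 * (Suc k * (Suc (2 * k) choose Suc k))"
        using Suc_times_binomial[of k "Suc (2 * k)"] by (simp del: binomial_Suc_Suc)
      then show ?thesis
        unfolding Suc_times_binomial by (simp del: binomial_Suc_Suc)
    qed
    then have C: "of_nat (Suc k) * of_nat (2 * Suc k choose Suc k) = (2 * of_nat (2 * k + 1) * of_nat (2 * k choose k) :: 'a)"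
      by (metis of_nat_mult of_nat_numeral)
    have "Suc k * (r choose Suc k) = (r - k) * (r choose k)"
      using binomial_absorb_comp[of r k] binomial_absorption[of k r] by simp
    then have "of_nat (Suc k) * of_nat (r choose Suc k) = (of_nat (r - k) * of_nat (r choose k) :: 'a)"
      by (metis of_nat_mult)
    moreover have "of_nat (r - k) = (of_nat r - of_nat k :: 'a)"
      using Suc.prems by (simp add: of_nat_diff)
    ultimately have B: "of_nat (Suc k) * of_nat (r choose Suc k) = ((of_nat r - of_nat k) * of_nat (r choose k) :: 'a)"
      by simp
    have tt: "of_nat (2 * k + 1) * (1 - ?t) = 2 * (of_nat k - of_nat r :: 'a)"
    proof -
      have "of_nat (2 * k + 1) * (1 - ?t) = of_nat (2 * k + 1) - (of_nat p ^ a :: 'a)"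
        using nz(2) by (simp only: right_diff_distrib times_divide_eq_right nonzero_mult_div_cancel_left mult_1_right not_False_eq_True)
      also have "\<dots> = of_nat (2 * k + 1) - of_nat (2 * r + 1)"
        unfolding r[symmetric] by simp
      also have "\<dots> = 2 * (of_nat k - of_nat r)"
        by simp
      finally show ?thesis .
    qed
    have "of_nat (Suc k) * (of_nat (2 * Suc k choose Suc k) * ((1 + e) * (1 - ?t)))
        = (of_nat (Suc k) * of_nat (2 * Suc k choose Suc k)) * ((1 + e) * (1 - ?t))"
      by (simp only: mult.assoc)
    also have "\<dots> = 2 * (of_nat (2 * k + 1) * (1 - ?t)) * (of_nat (2 * k choose k) * (1 + e))"
      unfolding C by (simp only: mult_ac)
    also have "\<dots> = (of_nat (Suc k) * of_nat (r choose Suc k)) * (- 4) ^ Suc k"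
      unfolding tt e(2) B by (simp add: algebra_simps)
    finally have "of_nat (2 * Suc k choose Suc k) * ((1 + e) * (1 - ?t)) = of_nat (r choose Suc k) * (- 4) ^ Suc k"
      using nz(1) by (simp only: mult.assoc mult_cancel_left) simp
    moreover have "(1 + e) * (1 - ?t) = 1 + (e - ?t - e * ?t)"
      by (simp add: algebra_simps add_divide_distrib)
    moreover have "e - ?t - e * ?t \<in> ideal 1"
      using e(1) t ideal_subset by (intro ideal_diff ideal_mult_left) auto
    ultimately show ?case by metis
  qed
  then obtain e where e: "e \<in> ideal 1" "of_nat (2 * k choose k) * (1 + e) = of_nat (r choose k) * (- 4) ^ k"
    by blast
  have "- (of_nat (2 * k choose k) * e) \<in> ideal 1"
    by (intro ideal_uminus ideal_mult_left of_nat_closed e)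
  then show ?thesis
    unfolding e(2)[symmetric] by (simp add: algebra_simps)
qed

end

section \<open>Evaluation of the sums S, S0 and T\<close>

context p_integers
begin

context
  fixes a r :: nat and m :: int
  assumes odd: "odd p" and a: "a > 0" and m: "\<not> int p dvd m" and r: "p ^ a = 2 * r + 1"
begin

private abbreviation (input) "w \<equiv> lucas_u (m - 2) 1 (r + 1) + lucas_u (m - 2) 1 r"
private abbreviation (input) "harm k \<equiv> \<Sum>j=1..k. 1 / of_nat j :: 'a"
private abbreviation (input) "\<mu> \<equiv> of_int m :: 'a"
private abbreviation (input) "S0 \<equiv> \<Sum>k<p ^ a. of_nat (2 * k choose k) / \<mu> ^ k"
private abbreviation (input) "T \<equiv> of_nat p ^ a * (\<Sum>k<p ^ a. of_nat (2 * k choose k) * harm k / \<mu> ^ k)"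

private lemma m_nonzero: "\<mu> \<noteq> 0"
  using m by auto

private lemma power_m_not_dvd: "\<not> int p dvd m ^ n"
  using m prime by (metis prime_dvd_power prime_nat_int_transfer)

private lemma two_not_dvd: "\<not> int p dvd 2"
proof -
  have "p \<noteq> 2" using odd by auto
  then have "int p > 2" using prime_ge_2_nat[OF prime] by simp
  then show ?thesis using zdvd_not_zless[of 2 "int p"] by simp
qed

private lemma inverse_power_m_closed: "x \<in> R \<Longrightarrow> x / \<mu> ^ k \<in> R"
  using divide_closed[OF _ power_m_not_dvd] by simp

private lemma half_choose_twice_even:
  assumes "j \<in> {1..r}"
  shows "of_nat p ^ a / of_nat j - (- 2 * of_nat (p ^ a choose (2 * j))) \<in> ideal 2"
proof -
  have "of_nat (p ^ a choose (2 * j)) - (- 1) ^ (2 * j - 1) * (of_nat p ^ a / of_nat (2 * j)) \<in> ideal 2"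
    using assms r by (intro choose_prime_power_cong) auto
  moreover have "(- 1 :: 'a) ^ (2 * j - 1) = - 1"
    using assms by (simp add: uminus_power_if)
  ultimately have "2 * (of_nat (p ^ a choose (2 * j)) + of_nat p ^ a / of_nat (2 * j)) \<in> ideal 2"
    using ideal_mult_left[OF of_nat_closed[of 2]] by (simp del: distrib_left_numeral)
  moreover have "2 * (of_nat (p ^ a choose (2 * j)) + of_nat p ^ a / of_nat (2 * j))
     = of_nat p ^ a / of_nat j - (- 2 * of_nat (p ^ a choose (2 * j)) :: 'a)"
    using assms by (simp add: field_simps)
  ultimately show ?thesis by (simp only:)
qed

private lemma sum_even_choose:
  defines "y \<equiv> (\<mu> - 4) / \<mu>"
  shows "(\<Sum>j=1..r. - 2 * of_nat (p ^ a choose (2 * j)) * (y ^ r - y ^ (r - j)))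
    = 2 * 4 ^ r * (of_int w / \<mu> ^ r - y ^ r)"
proof -
  have atMost: "sum g {1..r} = sum g {..r} - g 0" for g :: "nat \<Rightarrow> 'a"
    by (simp add: atMost_atLeast0 sum.atLeast_Suc_atMost)
  have 1: "(\<Sum>j\<le>r. of_nat (p ^ a choose (2 * j)) * y ^ (r - j)) = 4 ^ r * of_int w / \<mu> ^ r"
  proof -
    have "(\<Sum>j\<le>r. of_nat (p ^ a choose (2 * j)) * y ^ (r - j))
        = (\<Sum>j\<le>r. of_int (int (2 * r + 1 choose (2 * j)) * (m - 4) ^ (r - j) * m ^ j)) / \<mu> ^ r"
      unfolding sum_divide_distrib r
    proof (intro sum.cong refl)
      fix j assume "j \<in> {..r}"
      then have "\<mu> ^ r = \<mu> ^ (r - j) * \<mu> ^ j" by (simp flip: power_add)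
      then show "of_nat (2 * r + 1 choose (2 * j)) * y ^ (r - j)
          = of_int (int (2 * r + 1 choose (2 * j)) * (m - 4) ^ (r - j) * m ^ j) / \<mu> ^ r"
        using m_nonzero by (simp add: y_def power_divide del: binomial_Suc_Suc)
    qed
    also have "(\<Sum>j\<le>r. of_int (int (2 * r + 1 choose (2 * j)) * (m - 4) ^ (r - j) * m ^ j)) = (4 ^ r * of_int w :: 'a)"
      unfolding of_int_sum[symmetric] sum_choose_odd_lucas by simp
    finally show ?thesis .
  qed
  have 2: "(\<Sum>j\<le>r. of_nat (p ^ a choose (2 * j))) = (4 ^ r :: 'a)"
    unfolding r by (rule sum_choose_odd_one)
  have 3: "(\<Sum>j=1..r. - 2 * of_nat (p ^ a choose (2 * j)) * (y ^ r - y ^ (r - j)))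
     = - 2 * ((\<Sum>j\<le>r. of_nat (p ^ a choose (2 * j))) * y ^ r - (\<Sum>j\<le>r. of_nat (p ^ a choose (2 * j)) * y ^ (r - j)))"
  proof -
    \<comment> \<open>The summand j = 0 may be added because y^r - y^(r-0) = 0.\<close>
    have "(\<Sum>j=1..r. - 2 * of_nat (p ^ a choose (2 * j)) * (y ^ r - y ^ (r - j)))
       = (\<Sum>j\<le>r. - 2 * of_nat (p ^ a choose (2 * j)) * (y ^ r - y ^ (r - j)))"
      unfolding atMost by simp
    also have "\<dots> = - 2 * (\<Sum>j\<le>r. of_nat (p ^ a choose (2 * j)) * y ^ r - of_nat (p ^ a choose (2 * j)) * y ^ (r - j))"
      unfolding sum_distrib_left by (intro sum.cong refl) (simp add: algebra_simps)
    finally show ?thesis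
      by (simp add: sum_subtractf sum_distrib_right)
  qed
  have "- 2 * (c * s - c * t / z) = 2 * c * (t / z - s)" for c s t z :: 'a
    by (simp add: algebra_simps)
  then show ?thesis
    unfolding 3 unfolding 1 2 .
qed

lemma harmonic_sum_cong:
  "T - 2 * of_int (m ^ r * w - (m * (m - 4)) ^ r) \<in> ideal 2"
proof -
  let ?q = "p ^ a" and ?Q = "of_nat p ^ a :: 'a"
  \<comment> \<open>The power (-4)^k from the central binomial joins the denominator m^k; then 1 + x
    = (m - 4) / m.\<close>
  define x where "x = - 4 / \<mu>"
  define y where "y = (\<mu> - 4) / \<mu>"
  have xy: "1 + x = y" using m_nonzero by (simp add: x_def y_def field_simps)
  have y: "y \<in> R"
    unfolding y_def using divide_closed[OF of_int_closed[of "m - 4"] m] by simp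
  define H where "H k = harm k" for k
  have 1: "T - (\<Sum>k<?q. of_nat (r choose k) * (harm k * x ^ k)) * ?Q \<in> ideal 2"
    unfolding H_def[symmetric]
  proof -
    have "?Q * (\<Sum>k<?q. of_nat (2 * k choose k) * H k / \<mu> ^ k) - (\<Sum>k<?q. of_nat (r choose k) * (H k * x ^ k)) * ?Q
      = (\<Sum>k<?q. (1 / \<mu> ^ k) * ((of_nat (2 * k choose k) - of_nat (r choose k) * (- 4) ^ k) * (?Q * H k)))"
      unfolding sum_distrib_left sum_distrib_right sum_subtractf[symmetric] x_def power_divide
      by (intro sum.cong refl) (simp add: diff_divide_distrib algebra_simps)
    also have "\<dots> \<in> ideal 2"
      unfolding H_def
      by (intro ideal_sum ideal_mult_left inverse_power_m_closed one_closed ideal_mult_1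
          central_binomial_cong_half[OF r] prime_power_harmonic_in_ideal) auto
    finally show "?Q * (\<Sum>k<?q. of_nat (2 * k choose k) * H k / \<mu> ^ k) - (\<Sum>k<?q. of_nat (r choose k) * (H k * x ^ k)) * ?Q \<in> ideal 2" .
  qed
  have "(\<Sum>k<?q. of_nat (r choose k) * (harm k * x ^ k)) = (\<Sum>k\<le>r. of_nat (r choose k) * (harm k * x ^ k))"
    using r by (intro sum.mono_neutral_right) (auto simp: binomial_eq_0)
  also have "\<dots> * ?Q = (\<Sum>j=1..r. (?Q / of_nat j) * (y ^ r - y ^ (r - j)))"
    unfolding sum_choose_harmonic xy unfolding sum_distrib_right by (intro sum.cong refl) simp
  finally have 2: "(\<Sum>k<?q. of_nat (r choose k) * (harm k * x ^ k)) * ?Q = (\<Sum>j=1..r. (?Q / of_nat j) * (y ^ r - y ^ (r - j)))" .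
  have "(\<Sum>j=1..r. (?Q / of_nat j) * (y ^ r - y ^ (r - j))) - (\<Sum>j=1..r. - 2 * of_nat (?q choose (2 * j)) * (y ^ r - y ^ (r - j))) \<in> ideal 2"
    unfolding sum_subtractf[symmetric] left_diff_distrib[symmetric]
    by (intro ideal_sum ideal_mult_right half_choose_twice_even diff_closed power_closed y)
  then have "(\<Sum>k<?q. of_nat (r choose k) * (harm k * x ^ k)) * ?Q - 2 * 4 ^ r * (of_int w / \<mu> ^ r - y ^ r) \<in> ideal 2"
    unfolding 2 y_def sum_even_choose .
  from ideal_add[OF 1 this] have T: "T - 2 * 4 ^ r * (of_int w / \<mu> ^ r - y ^ r) \<in> ideal 2"
    by simp
  let ?B = "m ^ r * w - (m * (m - 4)) ^ r"
  \<comment> \<open>B is already divisible by p, so the factor 4^r / m^(2r) in front of it matters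
    only modulo p. There it is 1 by Fermat, since 4^r = 2^(q-1) and m^(2r) = m^(q-1).\<close>
  have B: "of_int ?B \<in> ideal 1"
    using cong_in_ideal[of "m ^ r * w" "(m * (m - 4)) ^ r" 1]
      half_sum_cong_discriminant[OF prime odd m r] by simp
  have "of_int w / \<mu> ^ r - y ^ r = of_int ?B / \<mu> ^ (2 * r)"
  proof -
    have aux: "W / M - D / M = (M * W - M * D) / (M * M)" if "M \<noteq> 0" for M W D :: 'a
      using that by (simp add: field_simps)
    have "of_int ?B = \<mu> ^ r * of_int w - \<mu> ^ r * (\<mu> - 4) ^ r"
      by (simp add: power_mult_distrib)
    then show ?thesis
      unfolding y_def power_divide mult_2 power_add using aux[of "\<mu> ^ r"] m_nonzero by simp
  qed
  then have "2 * 4 ^ r * (of_int w / \<mu> ^ r - y ^ r) - 2 * of_int ?B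
      = 2 * 4 ^ r * (of_int ?B / \<mu> ^ (2 * r)) - 2 * of_int ?B"
    by (simp only:)
  also have "\<dots> = (2 * of_int (4 ^ r - m ^ (2 * r)) / \<mu> ^ (2 * r)) * of_int ?B"
  proof -
    have "2 * c * (b / M) - 2 * b = (2 * (c - M) / M) * b" if "M \<noteq> 0" for b c M :: 'a
      using that by (simp add: field_simps)
    from this[of "\<mu> ^ (2 * r)" "4 ^ r" "of_int ?B"] show ?thesis
      using m_nonzero by simp
  qed
  also have "\<dots> \<in> ideal 2"
  proof (intro ideal_mult_1 B)
    have q1: "p ^ a - 1 = 2 * r" using r by simp
    have "[2 ^ (2 * r) = m ^ (2 * r)] ( mod int p)"
      using power_prime_power_minus_1_cong[OF prime two_not_dvd, of a]
        power_prime_power_minus_1_cong[OF prime m, of a] unfolding q1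
      using cong_trans cong_sym by blast
    then have "of_int (4 ^ r - m ^ (2 * r)) \<in> ideal 1"
      using cong_in_ideal[of "4 ^ r" "m ^ (2 * r)" 1] by (simp add: power_mult)
    then have "(of_int 2 / \<mu> ^ (2 * r)) * of_int (4 ^ r - m ^ (2 * r)) \<in> ideal 1"
      by (intro ideal_mult_left inverse_power_m_closed of_int_closed)
    then show "2 * of_int (4 ^ r - m ^ (2 * r)) / \<mu> ^ (2 * r) \<in> ideal 1"
      by (simp add: mult_ac)
  qed
  finally have "2 * 4 ^ r * (of_int w / \<mu> ^ r - y ^ r) - 2 * of_int ?B \<in> ideal 2" .
  with T show ?thesis by (rule ideal_trans)
qed

lemma central_binomial_sum_cong:
  "of_int (m ^ r) ^ 2 * S0 - of_int (2 * (m ^ r * w) - lucas_u (m - 2) 1 (p ^ a)) \<in> ideal 2"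
proof -
  have *: "of_int (m ^ r) ^ 2 * S0 = of_int (\<Sum>k<p ^ a. int (2 * k choose k) * m ^ (p ^ a - 1 - k))"
    unfolding of_int_sum sum_distrib_left
  proof (intro sum.cong refl)
    fix k assume "k \<in> {..<p ^ a}"
    then have "p ^ a - 1 - k + k = r + r"
      using r by simp
    then have "\<mu> ^ (r + r) = \<mu> ^ (p ^ a - 1 - k) * \<mu> ^ k"
      by (simp only: power_add[symmetric])
    then show "of_int (m ^ r) ^ 2 * (of_nat (2 * k choose k) / \<mu> ^ k) = of_int (int (2 * k choose k) * m ^ (p ^ a - 1 - k))"
      using m_nonzero by (simp add: power2_eq_square power_add)
  qed
  show ?thesis
    unfolding * by (rule cong_in_ideal[OF sum_central_binomial_cong[OF prime odd m r]])
qed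

lemma gbinomial_sum_cong:
  assumes h: "h \<in> R"
  defines "S \<equiv> \<Sum>k<p ^ a. ((h * of_nat p ^ a - 1) gchoose k) * of_nat (2 * k choose k) / (- \<mu>) ^ k"
  shows "S - (S0 - h * T) \<in> ideal 2"
proof -
  let ?c = "\<lambda>k. of_nat (2 * k choose k) / \<mu> ^ k"
  let ?g = "\<lambda>k. (h * of_nat p ^ a - 1) gchoose k"
  define H where "H k = harm k" for k
  have "S - (S0 - h * (of_nat p ^ a * (\<Sum>k<p ^ a. of_nat (2 * k choose k) * H k / \<mu> ^ k)))
      = (\<Sum>k<p ^ a. ((- 1) ^ k * ?c k) * (?g k - (- 1) ^ k * (1 - h * (of_nat p ^ a * H k))))"
    unfolding S_def sum_distrib_left sum_subtractf[symmetric]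
  proof (intro sum.cong refl)
    fix k
    have "(- \<mu>) ^ k = (- 1) ^ k * \<mu> ^ k" by (rule power_minus)
    then show "?g k * of_nat (2 * k choose k) / (- \<mu>) ^ k
        - (?c k - h * (of_nat p ^ a * (of_nat (2 * k choose k) * H k / \<mu> ^ k)))
      = ((- 1) ^ k * ?c k) * (?g k - (- 1) ^ k * (1 - h * (of_nat p ^ a * H k)))"
      using m_nonzero by (cases "even k") (simp_all add: field_simps)
  qed
  also have "\<dots> \<in> ideal 2"
    unfolding H_def using h by (intro ideal_sum ideal_mult_left mult_closed power_closed uminus_closed one_closed
        inverse_power_m_closed of_nat_closed gbinomial_prime_power_cong) auto
  finally show ?thesis unfolding H_def .
qed

lemma central_binomial_sum_closed: "S0 \<in> R"
  by (intro sum_closed inverse_power_m_closed of_nat_closed)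

lemma harmonic_sum_closed: "T \<in> R"
proof -
  have "of_int 2 * of_int (m ^ r * w - (m * (m - 4)) ^ r) \<in> R"
    by (intro mult_closed of_int_closed)
  then have "T - 2 * of_int (m ^ r * w - (m * (m - 4)) ^ r) + 2 * of_int (m ^ r * w - (m * (m - 4)) ^ r) \<in> R"
    using harmonic_sum_cong ideal_subset by (intro add_closed) auto
  then show ?thesis by simp
qed

text \<open>The third conclusion serves the case h m == 2: there 1 - h m / 2 is divisible by p, and
  together with U the whole term vanishes modulo p^2.\<close>

theorem gbinomial_central_binomial_sum_cong:
  fixes h :: 'a
  assumes h: "h \<in> R"
  defines "S \<equiv> \<Sum>k<p ^ a. ((h * of_nat p ^ a - 1) gchoose k) * of_nat (2 * k choose k) / (- \<mu>) ^ k"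
  defines "e \<equiv> Legendre (m * (m - 4)) (int p)"
  defines "U \<equiv> lucas_u (m - 2) 1 (nat (int p - e))"
  shows "S \<in> R"
    and "S - (of_int (e ^ (a - 1)) * (1 - h * \<mu> / 2) * of_int U
      + of_int (e ^ a) * (1 + h * (of_int (m - 4) ^ (p - 1) - 1))
      - (if p ^ a = 3 \<and> 3 dvd m - 1 then h * of_int (m - 4) else 0)) \<in> ideal 2"
    and "of_int U \<in> ideal 1"
proof -
  note congs = half_sum_congs[OF prime odd m r a, folded e_def, folded U_def]
  note S = gbinomial_sum_cong[OF h, folded S_def]
  have "S0 - h * T \<in> R"
    by (intro diff_closed mult_closed h central_binomial_sum_closed harmonic_sum_closed)
  then have "S - (S0 - h * T) + (S0 - h * T) \<in> R"
    using S ideal_subset by (intro add_closed) auto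
  then show "S \<in> R" by simp
  show "of_int U \<in> ideal 1"
    using of_int_in_ideal[of 1 U] congs(3) by simp
  define V where "V = e ^ a + e ^ (a - 1) * U"
  have "of_int (m ^ r) ^ 2 * S0 - of_int ((m ^ r)\<^sup>2 * V) \<in> ideal 2"
    using ideal_add[OF central_binomial_sum_cong cong_in_ideal[OF congs(1)]] by (simp add: V_def)
  then have "of_int ((m ^ r)\<^sup>2) * (S0 - of_int V) \<in> ideal 2"
    by (simp add: right_diff_distrib)
  moreover have "\<not> int p dvd (m ^ r)\<^sup>2"
    unfolding power_mult[symmetric] by (rule power_m_not_dvd)
  ultimately have S0: "S0 - of_int V \<in> ideal 2"
    using ideal_cancel_unit by blast
  define K where "K = (m - 4) ^ (p - 1) - 1"
  define c where "c = (if p ^ a = 3 \<and> 3 dvd m - 1 then m - 4 else 0)"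
  let ?B = "m ^ r * w - (m * (m - 4)) ^ r"
  have "[4 * ?B = e ^ (a - 1) * m * U - 2 * e ^ a * K + 2 * c] ( mod int p ^ 2)"
    using congs(2) unfolding K_def c_def by (cases "p ^ a = 3 \<and> 3 dvd m - 1") (simp_all only: if_True if_False mult_zero_right simp_thms)
  from cong_in_ideal[OF this] have "of_int (4 * ?B) - of_int (e ^ (a - 1) * m * U - 2 * e ^ a * K + 2 * c) \<in> ideal 2" .
  moreover have "of_int 2 * (T - 2 * of_int ?B) \<in> ideal 2"
    by (intro ideal_mult_left of_int_closed harmonic_sum_cong)
  \<comment> \<open>The integer congruence concerns 4 B, so T is doubled and the unit 2 is cancelled
    afterwards.\<close>
  ultimately have "of_int 2 * (T - 2 * of_int ?B) + (of_int (4 * ?B) - of_int (e ^ (a - 1) * m * U - 2 * e ^ a * K + 2 * c)) \<in> ideal 2"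
    by (intro ideal_add)
  then have "of_int 2 * (T - (of_int (e ^ (a - 1) * m * U) / 2 - of_int (e ^ a * K) + of_int c)) \<in> ideal 2"
    by (simp add: algebra_simps)
  then have T: "T - (of_int (e ^ (a - 1) * m * U) / 2 - of_int (e ^ a * K) + of_int c) \<in> ideal 2"
    by (rule ideal_cancel_unit[OF two_not_dvd])
  have "(S - (S0 - h * T)) + (S0 - of_int V) - h * (T - (of_int (e ^ (a - 1) * m * U) / 2 - of_int (e ^ a * K) + of_int c)) \<in> ideal 2"
    by (intro ideal_diff ideal_add S S0 ideal_mult_left h T)
  moreover have "(S - (S0 - h * T)) + (S0 - of_int V) - h * (T - (of_int (e ^ (a - 1) * m * U) / 2 - of_int (e ^ a * K) + of_int c))
     = S - (of_int (e ^ (a - 1)) * (1 - h * \<mu> / 2) * of_int U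
      + of_int (e ^ a) * (1 + h * (of_int (m - 4) ^ (p - 1) - 1))
      - h * of_int c)"
    by (simp add: V_def K_def algebra_simps)
  ultimately show "S - (of_int (e ^ (a - 1)) * (1 - h * \<mu> / 2) * of_int U
      + of_int (e ^ a) * (1 + h * (of_int (m - 4) ^ (p - 1) - 1))
      - (if p ^ a = 3 \<and> 3 dvd m - 1 then h * of_int (m - 4) else 0)) \<in> ideal 2"
    unfolding c_def by (simp only: if_distrib[of "\<lambda>z. h * of_int z"] of_int_0 mult_zero_right)
qed

end

end

section \<open>The ring of \<open>p\<close>-adic integers\<close>

lemma Rep_padic_int_of_int:
  "Rep_padic_int (of_int m :: 'p::prime_card padic_int) k = m mod int CARD('p) ^ k"
  by (cases m rule: int_diff_cases)
     (simp add: Rep_padic_int_of_nat minus_padic_int.rep_eq mod_simps)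

text \<open>The inverses modulo the powers of p are coherent because the inverse in the range from 0
  to p^n - 1 is unique.\<close>

lemma padic_int_unit:
  assumes "\<not> int CARD('p) dvd m"
  shows "\<exists>z :: 'p::prime_card padic_int. of_int m * z = 1"
proof -
  let ?p = "int CARD('p)"
  let ?y = "\<lambda>n. modular_inverse (?p ^ n) m"
  have "prime ?p" by (rule prime_card_int)
  then have "?p > 0" by (simp add: prime_gt_0_int)
  have "coprime m (?p ^ n)" for n
    using assms \<open>prime ?p\<close> by (metis coprime_commute coprime_power_right_iff prime_imp_coprime)
  then have inv: "[m * ?y n = 1] ( mod ?p ^ n)" for n
    by (rule cong_modular_inverse1)
  have "?y (Suc n) mod ?p ^ n = ?y n" for n
  proof (rule modular_inverse_int_eqI[symmetric])
    have "[m * ?y (Suc n) = 1] ( mod ?p ^ n)"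
      using inv[of "Suc n"] by (rule cong_dvd_modulus) simp
    moreover have "[m * (?y (Suc n) mod ?p ^ n) = m * ?y (Suc n)] ( mod ?p ^ n)"
      by (simp add: cong_def mod_simps)
    ultimately show "[m * (?y (Suc n) mod ?p ^ n) = 1] ( mod ?p ^ n)"
      using cong_trans by blast
  qed (use \<open>?p > 0\<close> in simp)
  then have Rep: "Rep_padic_int (Abs_padic_int ?y :: 'p padic_int) = ?y"
    by (intro Abs_padic_int_inverse) simp
  have "of_int m * (Abs_padic_int ?y :: 'p padic_int) = 1"
    using inv by (simp add: Rep_padic_int_inject[symmetric] fun_eq_iff times_padic_int.rep_eq
        one_padic_int.rep_eq Rep_padic_int_of_int Rep cong_def mod_simps)
  then show ?thesis by blast
qed

lemma of_int_eq_to_fract: "(of_int m :: 'a::{idom,ring_char_0} fract) = to_fract (of_int m)"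
proof -
  have "(of_nat n :: 'a fract) = to_fract (of_nat n)" for n
    by (induction n) simp_all
  then show ?thesis
    by (cases m rule: int_diff_cases) simp
qed

lemma p_integers_padic: "p_integers CARD('p) (padic_integers :: 'p::prime_card padic set)"
proof
  show "Factorial_Ring.prime CARD('p)" by (rule prime_card)
  show "(1 :: 'p padic) \<in> \<int>\<^sub>p"
    unfolding padic_integers_def by (metis rangeI to_fract_1)
next
  fix x y :: "'p padic"
  assume "x \<in> \<int>\<^sub>p" "y \<in> \<int>\<^sub>p"
  then show "x - y \<in> \<int>\<^sub>p" "x * y \<in> \<int>\<^sub>p"
    unfolding padic_integers_def
    by (auto simp flip: to_fract_diff to_fract_mult)
next
  fix m assume m: "\<not> int CARD('p) dvd m"
  then obtain z :: "'p padic_int" where "of_int m * z = 1"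
    using padic_int_unit by blast
  then have "of_int m * to_fract z = (1 :: 'p padic)"
    unfolding of_int_eq_to_fract to_fract_mult[symmetric] by simp
  then have "inverse (of_int m) = to_fract z"
    by (rule inverse_unique)
  then show "inverse (of_int m) \<in> (\<int>\<^sub>p :: 'p padic set)"
    by (simp add: padic_integers_def)
qed

theorem theorem1p2:
  fixes p a :: nat and m \<Delta> :: int and h S \<epsilon> \<epsilon>' :: "'p::prime_card padic"
  defines "p \<equiv> CARD('p)"
    and "\<Delta> \<equiv> m * (m - 4)"
    and "S \<equiv> (\<Sum>k = 0..p ^ a - 1.
           ((h * of_nat p ^ a - 1) gchoose k) * of_nat ((2 * k) choose k) / (- of_int m) ^ k)"
    and "\<epsilon> \<equiv> (if p ^ a = 3 \<and> 3 dvd m - 1 then h * of_int (m - 4) else 0)"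
    and "\<epsilon>' \<equiv> (if p ^ a = 3 \<and> 3 dvd m - 1 then of_int (m - 4) else 0)"
  assumes "odd p" and "a > 0" and "\<not> int p dvd m" and "h \<in> \<int>\<^sub>p"
  shows "[S = of_int (jacobi_prime_power \<Delta> p (a - 1)) * (1 - h * of_int m / 2)
                * of_int (lucas_u (m - 2) 1 (nat (int p - Legendre \<Delta> (int p))))
              + of_int (jacobi_prime_power \<Delta> p a) * (1 + h * (of_int (m - 4) ^ (p - 1) - 1))
              - \<epsilon>] (mod (of_nat p)\<^sup>2 in \<int>\<^sub>p)
    \<and> ([h * of_int m = 2] (mod of_nat p in \<int>\<^sub>p) \<longrightarrow>
         [S = of_int (jacobi_prime_power \<Delta> p a) * (1 + h * (of_int (m - 4) ^ (p - 1) - 1))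
              + \<epsilon>'] (mod (of_nat p)\<^sup>2 in \<int>\<^sub>p))"
proof -
  interpret Zp: p_integers p "\<int>\<^sub>p :: 'p padic set"
    unfolding p_def by (rule p_integers_padic)
  \<comment> \<open>\<open>padic_cong\<close> also asks for integrality of y, which follows from
    that of x and of the difference.\<close>
  have congI: "[x = y] (mod (of_nat p)\<^sup>2 in \<int>\<^sub>p)" if "x \<in> \<int>\<^sub>p" "x - y \<in> Zp.ideal 2" for x y :: "'p padic"
  proof -
    have "x - y \<in> \<int>\<^sub>p"
      using that(2) Zp.ideal_subset by blast
    with that(1) have "x - (x - y) \<in> \<int>\<^sub>p"
      by (rule Zp.diff_closed)
    then show ?thesis
      using that by (auto simp: padic_cong_def Zp.ideal_def)
  qed
  have "p ^ a > 0" using Zp.prime by (simp add: prime_gt_0_nat)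
  then have range: "{0..p ^ a - 1} = {..<p ^ a}"
    by (cases "p ^ a") (simp_all only: lessThan_Suc_atMost atMost_atLeast0 diff_Suc_1)
  obtain r where r: "p ^ a = 2 * r + 1"
    using odd_power_eq_double_Suc[OF \<open>odd p\<close>, of a] by blast
  note main = Zp.gbinomial_central_binomial_sum_cong[OF \<open>odd p\<close> \<open>a > 0\<close> \<open>\<not> int p dvd m\<close> r \<open>h \<in> \<int>\<^sub>p\<close>,
      folded range, folded S_def \<epsilon>_def \<Delta>_def jacobi_prime_power_def]
  let ?J = "of_int (jacobi_prime_power \<Delta> p (a - 1)) :: 'p padic"
    and ?U = "of_int (lucas_u (m - 2) 1 (nat (int p - Legendre \<Delta> (int p)))) :: 'p padic"
    and ?E = "of_int (jacobi_prime_power \<Delta> p a) * (1 + h * (of_int (m - 4) ^ (p - 1) - 1))"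
  have "[S = ?E + \<epsilon>'] (mod (of_nat p)\<^sup>2 in \<int>\<^sub>p)" if "[h * of_int m = 2] (mod of_nat p in \<int>\<^sub>p)"
  proof (rule congI)
    have two: "\<not> int p dvd 2"
      using \<open>odd p\<close> Zp.prime by (metis even_numeral int_dvd_int_iff of_nat_numeral primes_dvd_imp_eq two_is_prime_nat)
    have hm: "h * of_int m - 2 \<in> Zp.ideal 1"
      using that by (auto simp: padic_cong_def Zp.ideal_def)
    then have "of_int 2 * (1 - h * of_int m / 2) \<in> Zp.ideal 1"
      using Zp.ideal_uminus by (fastforce simp: algebra_simps)
    then have "1 - h * of_int m / 2 \<in> Zp.ideal 1"
      by (rule Zp.ideal_cancel_unit[OF two])
    then have "?J * ((1 - h * of_int m / 2) * ?U) \<in> Zp.ideal 2"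
      by (intro Zp.ideal_mult_left Zp.ideal_mult_1 main(3) Zp.of_int_closed)
    then have JU: "?J * (1 - h * of_int m / 2) * ?U \<in> Zp.ideal 2"
      by (simp only: mult.assoc)
    \<comment> \<open>To pass from -\<epsilon> to +\<epsilon>', (h + 1) (m - 4) must vanish modulo
      9. Indeed m == 1 and h m == 2 (mod 3) force h == -1.\<close>
    have eps: "\<epsilon> + \<epsilon>' \<in> Zp.ideal 2"
    proof (cases "p ^ a = 3 \<and> 3 dvd m - 1")
      case True
      have "p dvd 3" using \<open>a > 0\<close> True by (metis dvd_power)
      moreover have "Factorial_Ring.prime (3 :: nat)" by simp
      ultimately have "p = 3" using Zp.prime primes_dvd_imp_eq by blast
      have "m - 4 = (m - 1) - 3" by simp
      then have "int p dvd m - 4" using True \<open>p = 3\<close> by (metis dvd_diff dvd_refl of_nat_numeral)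
      then have m4: "of_int (m - 4) \<in> Zp.ideal 1"
        by (intro Zp.of_int_in_ideal) simp
      have three: "of_int 3 \<in> Zp.ideal 1"
        by (intro Zp.of_int_in_ideal) (simp add: \<open>p = 3\<close>)
      note hm4 = Zp.ideal_mult_left[OF \<open>h \<in> \<int>\<^sub>p\<close> m4] and h3 = Zp.ideal_mult_left[OF \<open>h \<in> \<int>\<^sub>p\<close> three]
      \<comment> \<open>The combination equals h + 1, and each of its four terms lies in
        \<open>ideal 1\<close>.\<close>
      have "(h * of_int m - 2) - h * of_int (m - 4) + of_int 3 - h * of_int 3 \<in> Zp.ideal 1"
        by (rule Zp.ideal_diff[OF Zp.ideal_add[OF Zp.ideal_diff[OF hm hm4] three] h3])
      then have "h + 1 \<in> Zp.ideal 1"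
        by (simp add: algebra_simps)
      then have "(h + 1) * of_int (m - 4) \<in> Zp.ideal 2"
        using m4 by (rule Zp.ideal_mult_1)
      then show ?thesis using True by (simp add: \<epsilon>_def \<epsilon>'_def algebra_simps)
    next
      case False
      then show ?thesis unfolding \<epsilon>_def \<epsilon>'_def by (simp only: if_False Zp.ideal_zero add_0)
    qed
    have "(S - (?J * (1 - h * of_int m / 2) * ?U + ?E - \<epsilon>)) + ?J * (1 - h * of_int m / 2) * ?U - (\<epsilon> + \<epsilon>') \<in> Zp.ideal 2"
      by (rule Zp.ideal_diff[OF Zp.ideal_add[OF main(2) JU] eps])
    then show "S - (?E + \<epsilon>') \<in> Zp.ideal 2"
      by (simp add: algebra_simps)
  qed (rule main(1))
  with congI[OF main(1,2)] show ?thesis by blast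
qed

end
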